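(* Let $C\subseteq\mathbb R^d$ be a salient polyhedral convex cone with order unit $u$ (i.e. $u\in{\rm int}(C)$). Then the smallest operator system $C^{\min}$ is finite-dimensional realizable if and only if $C$ is a simplex cone. Moreover, $C^{\min}=C^{\max}$ (i.e. $C_s^{\min}=C_s^{\max}$ for all $s\ge1$) if and only if $C$ is a simplex cone.
   Context: ${\rm Her}_s(\mathbb C)$ denotes the Hermitian $s\times s$ matrices; $\geqslant 0$ denotes positive semidefiniteness. A convex cone $C$ is salient if $C\cap(-C)=\{0\}$; polyhedral means an intersection of finitely many closed linear half-spaces. A cone in $\mathbb R^d$ (with nonempty interior) is a simplex (cone) if it is generated by $d$ linearly independent vectors, i.e. it is linearly isomorphic to $\mathbb R_{\ge0}^d$. For $c\in\mathbb R^d$ and $P\in{\rm Her}_s(\mathbb C)$, $c\otimes P:=(c_1P,\ldots,c_dP)\in{\rm Her}_s(\mathbb C)^d$. For $s\ge 1$ define $$C_s^{\min}:=\Big\{\sum_i c_i\otimes P_i\ \text{(finite sums)}\ \Big|\ c_i\in C,\ P_i\in{\rm Her}_s(\mathbb C),\ P_i\geqslant0\Big\},$$ $$C_s^{\max}:=\{(A_1,\ldots,A_d)\in{\rm Her}_s(\mathbb C)^d\mid (v^*A_1v,\ldots,v^*A_dv)\in C\ \text{ for all } v\in\mathbb C^s\},$$ and $C^{\min}=(C_s^{\min})_{s\ge1}$, $C^{\max}=(C_s^{\max})_{s\ge1}$, both with order unit $u$. $C^{\min}$ is finite-dimensional realizable if for some $r$ there are $T_1,\ldots,T_d\in{\rm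 Her}_r(\mathbb C)$ with $\sum_iu_iT_i=I_r$ such that for all $s\ge1$ and $A\in{\rm Her}_s(\mathbb C)^d$: $A\in C_s^{\min}\Leftrightarrow T_1\otimes A_1+\cdots+T_d\otimes A_d\geqslant0$. *)

theory Defs
  imports "HOL-Analysis.Analysis" "Jordan_Normal_Form.Schur_Decomposition"
begin

section \<open>Cones in \<open>\<real>\<^sup>d\<close>\<close>

definition salient :: "'a::real_vector set \<Rightarrow> bool" where
  "salient C \<longleftrightarrow> C \<inter> uminus ` C = {0}"

text \<open>Compare \<^const>\<open>polyhedron\<close>, which allows affine half-spaces.\<close>

definition polyhedral_cone :: "'a::real_inner set \<Rightarrow> bool" where
  "polyhedral_cone C \<longleftrightarrow>
     (\<exists>F. finite F \<and> C = \<Inter> F \<and> (\<forall>h\<in>F. \<exists>a. a \<noteq> 0 \<and> h = {x. 0 \<le> inner a x}))"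

definition simplex_cone :: "'a::euclidean_space set \<Rightarrow> bool" where
  "simplex_cone C \<longleftrightarrow>
     (\<exists>B. independent B \<and> card B = DIM('a) \<and> C = convex_cone hull B)"

section \<open>Hermitian matrices\<close>

definition Her :: "nat \<Rightarrow> complex mat set" where
  "Her s = {A \<in> carrier_mat s s. mat_adjoint A = A}"

text \<open>The number \<open>v\<^sup>* A v\<close>; recall that \<open>x \<bullet>c y\<close> conjugates its second argument.\<close>

definition qform :: "complex mat \<Rightarrow> complex Matrix.vec \<Rightarrow> complex" where
  "qform A v = (A *\<^sub>v v) \<bullet>c v"

text \<open>In the order on \<^typ>\<open>complex\<close>, \<open>0 \<le> z\<close> means that \<open>z\<close> is real and nonnegative.\<close>

definition psd :: "nat \<Rightarrow> complex mat \<Rightarrow> bool" where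
  "psd s A \<longleftrightarrow> A \<in> Her s \<and> (\<forall>v\<in>carrier_vec s. 0 \<le> qform A v)"

text \<open>Matrices of a fixed size do not form a type, so finite sums of \<open>n \<times> n\<close> matrices are
  formed entrywise; the empty sum is \<open>0\<^sub>m n n\<close>.\<close>

definition sum_mat :: "nat \<Rightarrow> ('i \<Rightarrow> complex mat) \<Rightarrow> 'i set \<Rightarrow> complex mat" where
  "sum_mat n M I = Matrix.mat n n (\<lambda>(a, b). \<Sum>i\<in>I. M i $$ (a, b))"

definition kronecker :: "complex mat \<Rightarrow> complex mat \<Rightarrow> complex mat" (infixl \<open>\<otimes>\<^sub>K\<close> 70) where
  "A \<otimes>\<^sub>K B = Matrix.mat (dim_row A * dim_row B) (dim_col A * dim_col B)
     (\<lambda>(i, j). A $$ (i div dim_row B, j div dim_col B) * B $$ (i mod dim_row B, j mod dim_col B))"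

section \<open>The smallest and the largest operator system over a cone\<close>

text \<open>A \<open>d\<close>-tuple of matrices is a function on the index type \<open>'d\<close> of \<open>\<real>\<^sup>d\<close>.\<close>

definition tensor_tuple :: "real ^ 'd \<Rightarrow> complex mat \<Rightarrow> 'd \<Rightarrow> complex mat" where
  "tensor_tuple c P = (\<lambda>k. complex_of_real (vec_nth c k) \<cdot>\<^sub>m P)"

definition C_min :: "(real ^ 'd) set \<Rightarrow> nat \<Rightarrow> ('d \<Rightarrow> complex mat) set" where
  "C_min C s = {A. \<exists>(m::nat) c P. (\<forall>i<m. c i \<in> C \<and> psd s (P i)) \<and>
     A = (\<lambda>k. sum_mat s (\<lambda>i. tensor_tuple (c i) (P i) k) {..<m})}"

text \<open>For Hermitian \<open>A k\<close> the number \<open>qform (A k) v\<close> is real, so taking \<^const>\<open>Re\<close> is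
  only a coercion.\<close>

definition C_max :: "(real ^ 'd) set \<Rightarrow> nat \<Rightarrow> ('d \<Rightarrow> complex mat) set" where
  "C_max C s = {A. (\<forall>k. A k \<in> Her s) \<and> (\<forall>v\<in>carrier_vec s. (\<chi> k. Re (qform (A k) v)) \<in> C)}"

definition fd_realizable :: "(nat \<Rightarrow> ('d::finite \<Rightarrow> complex mat) set) \<Rightarrow> real ^ 'd \<Rightarrow> bool" where
  "fd_realizable S u \<longleftrightarrow>
     (\<exists>r T. r \<ge> 1 \<and> (\<forall>k. T k \<in> Her r) \<and>
        sum_mat r (\<lambda>k. complex_of_real (vec_nth u k) \<cdot>\<^sub>m T k) UNIV = 1\<^sub>m r \<and>
        (\<forall>s\<ge>1. \<forall>A. (\<forall>k. A k \<in> Her s) \<longrightarrow>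
           (A \<in> S s \<longleftrightarrow> psd (r * s) (sum_mat (r * s) (\<lambda>k. T k \<otimes>\<^sub>K A k) UNIV))))"

end

theory Submission
  imports Defs "HOL-Library.Function_Algebras"
begin

text \<open>A simplex cone has a dual basis, and applying it to a tuple in \<open>C_max\<close> writes the tuple as an
  element of \<open>C_min\<close>. For a polyhedral cone \<open>C_max\<close> is realized by diagonal matrices, so it remains to
  show that a realizable \<open>C_min\<close> forces a simplex.

  If \<open>C\<close> is not a simplex, some facet misses a whole face of dimension at least two. A longest chord
  argument yields \<open>c1 + c3 = c2 + c4\<close> with \<open>c1, c2\<close> in that face and \<open>c3, c4\<close> in the facet, and a
  linear map to \<open>\<real>\<^sup>3\<close> under which the four points lie on two disjoint edges of the image of \<open>C\<close>.
  Near these edges \<open>C\<close> fits into a one-parameter family of Lorentz cones, that is, of positive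
  \<open>2 \<times> 2\<close> matrices, on whose boundary the four points lie. Testing a realization \<open>T\<close> on the
  corresponding boundary elements of \<open>C_min\<close> gives kernel vectors showing that \<open>1 - s\<close> is an
  eigenvalue of the pencil made of \<open>T(c1)\<close>, \<open>T(c2)\<close> and \<open>T(c1 + c3)\<close>, for all small \<open>s > 0\<close>. This is
  impossible for matrices of a fixed size.\<close>

text \<open>In the coordinates \<open>(f, g, h)\<close> the points \<open>c1, c2, c3, c4\<close> are
  \<open>(1, 0, 0)\<close>, \<open>(1, 1, 0)\<close>, \<open>(0, 0, 1)\<close>,
  \<open>(0, -1, 1)\<close>. The conics through them form the pencil
  \<open>f h + s g (f - g - h) = 0\<close>, spanned by two line pairs: \<open>f h = 0\<close> joins
  \<open>c1\<close> to \<open>c2\<close> and \<open>c3\<close> to \<open>c4\<close>, while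
  \<open>g (f - g - h) = 0\<close> joins \<open>c1\<close> to \<open>c3\<close> and
  \<open>c2\<close> to \<open>c4\<close>. The Lorentz cones are the members of this pencil close to
  \<open>f h = 0\<close>. Such a cone is the set where a symmetric matrix with entries linear in
  \<open>(f, g, h)\<close> is positive. Each \<open>ci\<close> goes to a matrix of rank one, and the
  projection onto its kernel, tensored with \<open>ci\<close>, pairs to zero with the map. This is
  where the vectors \<open>p\<close> and \<open>q\<close> used at the end come from. A single conic
  would give no contradiction, since a realization may well be singular on one boundary element; the
  whole interval of parameters is needed. Nothing is assumed about the invertibility of
  \<open>T(c1 + c3)\<close>, so the eigenvalue argument is carried out with forms, modulo their
  kernels.\<close>

no_notation Matrix.scalar_prod (infix "\<bullet>" 70)
no_notation Finite_Cartesian_Product.vec_nth (infixl "$" 90)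

section \<open>Polyhedral cones that are not simplices\<close>

text \<open>The ratio test of the simplex method: tilting \<open>f\<close> towards \<open>k\<close>
  is limited only by the \<open>v\<close> with \<open>k \<bullet> v < 0\<close>, and
  \<open>t\<close> is the least ratio at which one of them becomes a zero.\<close>

lemma pivot:
  fixes f k :: "'a::euclidean_space"
  assumes "finite V" and "w \<in> V" and "k \<bullet> w < 0"
    and nonneg: "\<And>v. v \<in> V \<Longrightarrow> 0 \<le> f \<bullet> v"
    and pos: "\<And>v. v \<in> V \<Longrightarrow> k \<bullet> v < 0 \<Longrightarrow> 0 < f \<bullet> v"
  obtains t v where "0 < t" "\<And>v. v \<in> V \<Longrightarrow> 0 \<le> (f + t *\<^sub>R k) \<bullet> v"
    "v \<in> V" "k \<bullet> v < 0" "(f + t *\<^sub>R k) \<bullet> v = 0"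
proof -
  let ?S = "{v \<in> V. k \<bullet> v < 0}" and ?q = "\<lambda>v. (f \<bullet> v) / (- (k \<bullet> v))"
  have S: "finite ?S" "?S \<noteq> {}" using assms by auto
  define v where "v = arg_min_on ?q ?S"
  have v: "v \<in> ?S" unfolding v_def by (rule arg_min_if_finite(1)[OF S])
  have min: "?q v \<le> ?q x" if "x \<in> ?S" for x
    unfolding v_def by (rule arg_min_least[OF S that])
  show thesis
  proof (rule that[of "?q v" v])
    show "0 < ?q v" using v pos[of v] by (simp add: divide_pos_neg)
    show "0 \<le> (f + ?q v *\<^sub>R k) \<bullet> x" if x: "x \<in> V" for x
    proof (cases "k \<bullet> x < 0")
      case True
      then have "?q v * (- (k \<bullet> x)) \<le> ?q x * (- (k \<bullet> x))" using min[of x] x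
        by (intro mult_right_mono) auto
      also have "\<dots> = f \<bullet> x" using True by simp
      finally show ?thesis unfolding inner_add_left inner_scaleR_left by linarith
    next
      case False
      have "0 \<le> ?q v" using v pos[of v] by (simp add: divide_nonneg_neg)
      then have "0 \<le> ?q v * (k \<bullet> x)" using False by (intro mult_nonneg_nonneg) auto
      then show ?thesis using nonneg[OF x] unfolding inner_add_left inner_scaleR_left by linarith
    qed
    show "v \<in> V" "k \<bullet> v < 0" using v by auto
    then show "(f + ?q v *\<^sub>R k) \<bullet> v = 0" unfolding inner_add_left inner_scaleR_left by simp
  qed
qed

text \<open>Take \<open>f\<close> with the most zeros in \<open>V\<close>. If these did not span the
  kernel of \<open>f\<close>, there would be a functional vanishing on them and at
  \<open>v0\<close>, but not on all of \<open>V\<close>. Tilting by it with \<open>pivot\<close>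
  gains a zero and keeps the value at \<open>v0\<close>. Thus \<open>f\<close> cuts out a facet that
  misses \<open>v0\<close>.\<close>

lemma ex_facet_functional:
  fixes f0 :: "'a::euclidean_space"
  assumes fin: "finite V" and sp: "span V = UNIV" and v0: "v0 \<in> V"
    and f0: "\<And>v. v \<in> V \<Longrightarrow> 0 \<le> f0 \<bullet> v" "0 < f0 \<bullet> v0"
  obtains f where "\<And>v. v \<in> V \<Longrightarrow> 0 \<le> f \<bullet> v" "0 < f \<bullet> v0"
    "\<And>z. f \<bullet> z = 0 \<Longrightarrow> z \<in> span {v \<in> V. f \<bullet> v = 0}"
proof -
  let ?P = "\<lambda>f. (\<forall>v\<in>V. 0 \<le> f \<bullet> v) \<and> 0 < f \<bullet> v0" and ?Z = "\<lambda>f. {v \<in> V. f \<bullet> v = 0}"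
  have "\<exists>f. ?P f \<and> (\<forall>g. ?P g \<longrightarrow> card (?Z g) \<le> card (?Z f))"
    by (rule ex_has_greatest_nat[of ?P f0 _ "Suc (card V)"])
      (use f0 fin in \<open>auto intro!: le_imp_less_Suc card_mono\<close>)
  then obtain f where f: "?P f" and max: "\<And>g. ?P g \<Longrightarrow> card (?Z g) \<le> card (?Z f)"
    by blast
  have "z \<in> span (?Z f)" if z: "f \<bullet> z = 0" for z
  proof (rule ccontr)
    assume nz: "z \<notin> span (?Z f)"
    obtain y w where y: "y \<in> span (?Z f)" and w: "\<And>x. x \<in> span (?Z f) \<Longrightarrow> Linear_Algebra.orthogonal w x"
      and zyw: "z = y + w" using orthogonal_subspace_decomp_exists[of "?Z f" z] by blast
    have "w \<noteq> 0" using nz y zyw by auto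
    then have wz: "w \<bullet> z \<noteq> 0" using w[OF y] zyw by (simp add: Linear_Algebra.orthogonal_def inner_add_right)
    define g where "g = w - ((w \<bullet> v0) / (f \<bullet> v0)) *\<^sub>R f"
    have g0: "g \<bullet> v0 = 0" using f by (simp add: g_def inner_diff_left)
    have gz: "g \<bullet> z \<noteq> 0" using wz z by (simp add: g_def inner_diff_left)
    have gF: "g \<bullet> v = 0" if "v \<in> ?Z f" for v
      using that w[OF span_base[OF that]] by (simp add: g_def inner_diff_left Linear_Algebra.orthogonal_def)
    have "\<exists>v\<in>V. g \<bullet> v \<noteq> 0"
    proof (rule ccontr)
      assume "\<not> ?thesis"
      then have "Linear_Algebra.orthogonal g z" using sp
        by (intro orthogonal_to_span[of z V]) (auto simp: Linear_Algebra.orthogonal_def)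
      then show False using gz by (simp add: Linear_Algebra.orthogonal_def)
    qed
    then obtain v where v: "v \<in> V" "g \<bullet> v \<noteq> 0" by blast
    obtain c :: real where c: "(c *\<^sub>R g) \<bullet> v < 0"
    proof (cases "g \<bullet> v < 0")
      case True then show thesis using that[of 1] by simp
    next
      case False then show thesis using v that[of "-1"] by simp
    qed
    have fpos: "0 < f \<bullet> u" if u: "u \<in> V" "(c *\<^sub>R g) \<bullet> u < 0" for u
    proof -
      have "f \<bullet> u \<noteq> 0" using gF[of u] u by auto
      then show ?thesis using f u by (simp add: less_le)
    qed
    have fnn: "\<And>u. u \<in> V \<Longrightarrow> 0 \<le> f \<bullet> u" using f by blast
    obtain t x where t: "0 < t" "\<And>v. v \<in> V \<Longrightarrow> 0 \<le> (f + t *\<^sub>R c *\<^sub>R g) \<bullet> v"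
      and x: "x \<in> V" "(c *\<^sub>R g) \<bullet> x < 0" "(f + t *\<^sub>R c *\<^sub>R g) \<bullet> x = 0"
      using pivot[OF fin v(1) c fnn fpos] by blast
    let ?f = "f + t *\<^sub>R c *\<^sub>R g"
    have "?P ?f" using t f g0 by (simp add: inner_add_left)
    then have "card (?Z ?f) \<le> card (?Z f)" by (rule max)
    moreover have "?Z f \<subset> ?Z ?f"
    proof
      show "?Z f \<subseteq> ?Z ?f" using gF by (auto simp: inner_add_left)
      have "x \<notin> ?Z f" using gF[of x] x by auto
      then show "?Z f \<noteq> ?Z ?f" using x by blast
    qed
    then have "card (?Z f) < card (?Z ?f)" using fin by (intro psubset_card_mono) auto
    ultimately show False by simp
  qed
  then show thesis using f that by blast
qed

section \<open>Chords of convex bodies\<close>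

text \<open>The set of differences is symmetric, so its relative interior contains some
  \<open>w\<close> together with \<open>- w\<close>, hence their midpoint.\<close>

lemma zero_in_rel_interior_differences:
  fixes Q :: "'a::euclidean_space set"
  assumes "convex Q" "Q \<noteq> {}"
  shows "0 \<in> rel_interior {x - y | x y. x \<in> Q \<and> y \<in> Q}"
proof -
  let ?K = "{x - y | x y. x \<in> Q \<and> y \<in> Q}"
  have "?K = (\<Union>x\<in>Q. \<Union>y\<in>Q. {x - y})" by blast
  then have K: "convex ?K" using convex_differences[OF assms(1,1)] by simp
  have "rel_interior ?K \<noteq> {}" using K assms(2) rel_interior_eq_empty[OF K] by blast
  then obtain w where w: "w \<in> rel_interior ?K" by blast
  have "uminus ` ?K = ?K" by (force simp: image_iff)
  then have "- w \<in> rel_interior ?K"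
  proof -
    have "rel_interior (uminus ` ?K) = uminus ` rel_interior ?K"
      by (rule rel_interior_injective_linear_image)
        (auto intro: inj_onI bounded_linear_minus[OF bounded_linear_ident])
    then show ?thesis using w \<open>uminus ` ?K = ?K\<close> by auto
  qed
  from convexD[OF convex_rel_interior[OF K] w this, of "1/2" "1/2"] show ?thesis by simp
qed

text \<open>The largest multiple of \<open>Z\<close> inside the difference body \<open>Q - Q\<close> touches the relative boundary,
  and a supporting functional at a contact point is maximal over \<open>Z\<close> there.\<close>

lemma supporting_chord:
  fixes Q Z :: "'a::euclidean_space set"
  assumes Q: "compact Q" "convex Q" "Q \<noteq> {}" and Z: "finite Z" "z0 \<in> Z" "z0 \<noteq> 0"
    and aff: "\<And>z. z \<in> Z \<Longrightarrow> z \<in> affine hull {x - y | x y. x \<in> Q \<and> y \<in> Q}"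
  shows "\<exists>t>0. \<exists>z\<in>Z. \<exists>x\<in>Q. \<exists>y\<in>Q. \<exists>p. t *\<^sub>R z = x - y \<and> 0 < p \<bullet> z \<and>
    (\<forall>q\<in>Q. p \<bullet> y \<le> p \<bullet> q \<and> p \<bullet> q \<le> p \<bullet> x) \<and> (\<forall>z'\<in>Z. p \<bullet> z' \<le> p \<bullet> z)"
proof -
  define K where "K = {x - y | x y. x \<in> Q \<and> y \<in> Q}"
  have KI: "x - y \<in> K" if "x \<in> Q" "y \<in> Q" for x y using that by (auto simp: K_def)
  have "K = (\<Union>x\<in>Q. \<Union>y\<in>Q. {x - y})" by (auto simp: K_def)
  then have cvx: "convex K" using convex_differences[OF Q(2,2)] by simp
  have cpt: "compact K" using compact_differences[OF Q(1,1)] by (simp add: K_def)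
  have ri0: "0 \<in> rel_interior K" using zero_in_rel_interior_differences[OF Q(2,3)] by (simp add: K_def)
  then have K0: "0 \<in> K" using rel_interior_subset by blast
  define L where "L = {t::real. 0 \<le> t \<and> (\<forall>z\<in>Z. t *\<^sub>R z \<in> K)}"
  have "0 \<in> L" using K0 by (simp add: L_def)
  have "L = {0..} \<inter> (\<Inter>z\<in>Z. (\<lambda>t. t *\<^sub>R z) -` K)" by (auto simp: L_def)
  moreover have "closed ((\<lambda>t::real. t *\<^sub>R z) -` K)" for z
    by (intro continuous_closed_vimage compact_imp_closed[OF cpt] continuous_intros)
  ultimately have "closed L" by (simp add: closed_Int closed_INT)
  obtain B where B: "\<And>k. k \<in> K \<Longrightarrow> norm k \<le> B"
    using compact_imp_bounded[OF cpt] unfolding bounded_iff by blast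
  have "L \<subseteq> {0..B / norm z0}"
  proof
    fix t assume "t \<in> L"
    then have "0 \<le> t" "t *\<^sub>R z0 \<in> K" using Z(2) by (auto simp: L_def)
    then show "t \<in> {0..B / norm z0}" using B[of "t *\<^sub>R z0"] Z(3) by (simp add: pos_le_divide_eq)
  qed
  then have "compact L" 
    using \<open>closed L\<close> bounded_subset[OF bounded_closed_interval] by (simp add: compact_eq_bounded_closed)
  then obtain t where t: "t \<in> L" and tmax: "\<And>s. s \<in> L \<Longrightarrow> s \<le> t"
    using compact_attains_sup[of L] \<open>0 \<in> L\<close> by blast
  \<comment> \<open>Otherwise each \<open>z\<close> leaves some slack \<open>d z\<close>, and the
    least of these finitely many slacks could be added to \<open>t\<close>.\<close>
  have "\<exists>z\<in>Z. t *\<^sub>R z \<notin> rel_interior K"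
  proof (rule ccontr)
    assume "\<not> ?thesis"
    then have ri: "t *\<^sub>R z \<in> rel_interior K" if "z \<in> Z" for z using that by blast
    have "\<exists>d>0. \<forall>s. 0 \<le> s \<and> s \<le> d \<longrightarrow> (t + s) *\<^sub>R z \<in> K" if z: "z \<in> Z" for z
    proof -
      obtain e where e: "e > 0" "ball (t *\<^sub>R z) e \<inter> affine hull K \<subseteq> K"
        using ri[OF z] mem_rel_interior_ball by blast
      define d where "d = e / (2 * (norm z + 1))"
      have d: "d > 0" using e by (simp add: d_def add_nonneg_pos)
      have "(t + s) *\<^sub>R z \<in> K" if s: "0 \<le> s" "s \<le> d" for s
      proof -
        have "s * norm z \<le> d * (norm z + 1)" using s by (intro mult_mono) auto
        also have "\<dots> = e / 2" 
        proof -
          have "norm z + 1 \<noteq> 0" using norm_ge_zero[of z] by linarith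
          then show ?thesis by (simp add: d_def divide_simps) (simp add: algebra_simps)?
        qed
        also have "\<dots> < e" using e by simp
        finally have "(t + s) *\<^sub>R z \<in> ball (t *\<^sub>R z) e"
          using s by (simp add: dist_norm scaleR_left_distrib)
        moreover have "(t + s) *\<^sub>R z \<in> affine hull K"
        proof -
          have "0 \<in> affine hull K" by (rule hull_inc[OF K0])
          then show ?thesis
            using mem_affine[OF affine_affine_hull aff[OF z, folded K_def] \<open>0 \<in> affine hull K\<close>, of "t + s" "1 - (t + s)"] by simp
        qed
        ultimately show ?thesis using e by blast
      qed
      then show ?thesis using d by blast
    qed
    then have "\<forall>z\<in>Z. \<exists>d. d > 0 \<and> (\<forall>s. 0 \<le> s \<and> s \<le> d \<longrightarrow> (t + s) *\<^sub>R z \<in> K)" by blast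
    from bchoice[OF this] obtain d where d: "\<And>z. z \<in> Z \<Longrightarrow> d z > 0"
      "\<And>z s. z \<in> Z \<Longrightarrow> 0 \<le> s \<Longrightarrow> s \<le> d z \<Longrightarrow> (t + s) *\<^sub>R z \<in> K" by blast
    define m where "m = Min (d ` Z)"
    have "m \<in> d ` Z" unfolding m_def using Z(1,2) by (intro Min_in) auto
    then have m: "m > 0" using d(1) by auto
    have md: "m \<le> d z" if "z \<in> Z" for z unfolding m_def using Z(1) that by simp
    have "t + m \<in> L" using m md d(2)[of _ m] t by (simp add: L_def)
    then show False using tmax[of "t + m"] m by simp
  qed
  then obtain z where z: "z \<in> Z" and nri: "t *\<^sub>R z \<notin> rel_interior K" by blast
  have tz: "t *\<^sub>R z \<in> K" using t z by (simp add: L_def)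
  have "t \<noteq> 0" using nri ri0 by auto
  then have t0: "0 < t" using t by (simp add: L_def)
  obtain x y where xy: "x \<in> Q" "y \<in> Q" "t *\<^sub>R z = x - y" using tz by (auto simp: K_def)
  obtain a where a: "\<And>k. k \<in> K \<Longrightarrow> a \<bullet> (t *\<^sub>R z) \<le> a \<bullet> k"
    and a': "\<And>k. k \<in> rel_interior K \<Longrightarrow> a \<bullet> (t *\<^sub>R z) < a \<bullet> k"
    by (rule supporting_hyperplane_rel_boundary[OF cvx tz nri]) blast
  have "0 < (- a) \<bullet> z" using a'[OF ri0] t0 by (simp add: mult_less_0_iff)
  \<comment> \<open>Comparing \<open>x - y\<close> with \<open>q - y\<close> and with
    \<open>x - q\<close> separates the extremality of the chord into that of \<open>x\<close> and
    that of \<open>y\<close>.\<close>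
  moreover have "(- a) \<bullet> y \<le> (- a) \<bullet> q \<and> (- a) \<bullet> q \<le> (- a) \<bullet> x" if q: "q \<in> Q" for q
  proof -
    have "a \<bullet> (x - y) \<le> a \<bullet> (q - y)" "a \<bullet> (x - y) \<le> a \<bullet> (x - q)"
      using a[OF KI[OF q xy(2)]] a[OF KI[OF xy(1) q]] xy(3) by simp_all
    then show ?thesis by (simp add: inner_diff_right)
  qed
  moreover have "(- a) \<bullet> z' \<le> (- a) \<bullet> z" if "z' \<in> Z" for z'
  proof -
    have "a \<bullet> (t *\<^sub>R z) \<le> a \<bullet> (t *\<^sub>R z')" using a[of "t *\<^sub>R z'"] t that by (simp add: L_def)
    then show ?thesis using t0 by simp
  qed
  ultimately show ?thesis using t0 z xy by blast
qed

section \<open>Facets and faces of salient polyhedral cones\<close>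

text \<open>The sum \<open>l\<close> of the normals is positive on nonzero points of
  \<open>C\<close>: if it vanishes at \<open>x\<close>, so does every normal, and \<open>- x\<close>
  lies in \<open>C\<close> as well. The slice \<open>l = 1\<close> is therefore a polytope, and its
  vertices generate the cone.\<close>

lemma salient_polyhedral_cone_generators:
  fixes C :: "'a::euclidean_space set"
  assumes cone: "convex_cone C" and poly: "polyhedral_cone C" and sal: "salient C"
  obtains V l where "finite V" "C = convex_cone hull V" "\<And>v. v \<in> V \<Longrightarrow> l \<bullet> v = 1"
    "\<And>v. v \<in> V \<Longrightarrow> \<exists>e. e \<bullet> v = 0 \<and> (\<forall>w\<in>V. w \<noteq> v \<longrightarrow> 0 < e \<bullet> w)"
proof -
  obtain F where F: "finite F" "C = \<Inter>F" and "\<forall>h\<in>F. \<exists>a. a \<noteq> 0 \<and> h = {x. 0 \<le> a \<bullet> x}"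
    using poly unfolding polyhedral_cone_def by blast
  from bchoice[OF this(3)] obtain a where a: "\<And>h. h \<in> F \<Longrightarrow> h = {x. 0 \<le> a h \<bullet> x}" by blast
  define l where "l = (\<Sum>h\<in>F. a h)"
  have memC: "x \<in> C \<longleftrightarrow> (\<forall>h\<in>F. 0 \<le> a h \<bullet> x)" for x using a F(2) by blast
  have l0: "0 \<le> l \<bullet> x" if "x \<in> C" for x
    using that unfolding l_def inner_sum_left memC by (intro sum_nonneg) blast
  have lpos: "0 < l \<bullet> x" if x: "x \<in> C" "x \<noteq> 0" for x
  proof (rule ccontr)
    assume "\<not> 0 < l \<bullet> x"
    then have "(\<Sum>h\<in>F. a h \<bullet> x) = 0" using l0[OF x(1)] by (simp add: l_def inner_sum_left)
    then have "\<forall>h\<in>F. a h \<bullet> x = 0" using x(1) F(1) memC by (simp add: sum_nonneg_eq_0_iff)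
    then have "- x \<in> C" by (simp add: memC)
    then have "x \<in> C \<inter> uminus ` C" using x(1) by (metis IntI image_eqI minus_minus)
    then show False using sal x(2) unfolding salient_def by blast
  qed
  define Q where "Q = C \<inter> {x. l \<bullet> x = 1}"
  have "polyhedron h" if "h \<in> F" for h
    by (subst a[OF that]) (rule polyhedron_halfspace_ge)
  then have "polyhedron C" unfolding F(2) using F(1) by (intro polyhedron_Inter) auto
  then have Qp: "polyhedron Q" unfolding Q_def by (intro polyhedron_Int polyhedron_hyperplane)
  have "bounded Q"
  proof (cases "C \<subseteq> {0}")
    case True
    then have "Q = {}" by (auto simp: Q_def)
    then show ?thesis by simp
  next
    case False
    let ?S = "C \<inter> sphere 0 1"
    have "compact ?S" using polyhedron_imp_closed[OF \<open>polyhedron C\<close>] by (intro closed_Int_compact) auto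
    moreover obtain x0 where "x0 \<in> C" "x0 \<noteq> 0" using False by blast
    then have "(1 / norm x0) *\<^sub>R x0 \<in> ?S" using convex_cone_scaleR[OF cone] by simp
    then have "?S \<noteq> {}" by blast
    moreover have "continuous_on ?S (\<lambda>x. l \<bullet> x)" by (intro continuous_intros)
    ultimately obtain y where y: "y \<in> ?S" and ymin: "\<And>x. x \<in> ?S \<Longrightarrow> l \<bullet> y \<le> l \<bullet> x"
      using continuous_attains_inf[of ?S "\<lambda>x. l \<bullet> x"] by blast
    have "y \<noteq> 0" using y by auto
    then have "0 < l \<bullet> y" using y lpos[of y] by simp
    have "norm x \<le> 1 / (l \<bullet> y)" if x: "x \<in> Q" for x
    proof -
      have "x \<noteq> 0" "x \<in> C" "l \<bullet> x = 1" using x by (auto simp: Q_def)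
      then have "(1 / norm x) *\<^sub>R x \<in> ?S" using convex_cone_scaleR[OF cone] by simp
      from ymin[OF this] show ?thesis
        using \<open>0 < l \<bullet> y\<close> \<open>l \<bullet> x = 1\<close> \<open>x \<noteq> 0\<close> by (simp add: field_simps)
    qed
    then show ?thesis unfolding bounded_iff by blast
  qed
  then have cpt: "compact Q" using polyhedron_imp_closed[OF Qp] by (simp add: compact_eq_bounded_closed)
  define V where "V = {x. x extreme_point_of Q}"
  have QV: "Q = convex hull V" unfolding V_def
    by (rule Krein_Milman_Minkowski[OF cpt polyhedron_imp_convex[OF Qp]])
  have VQ: "V \<subseteq> Q" using QV hull_subset[of V convex] by simp
  have CV: "C = convex_cone hull V"
  proof
    show "convex_cone hull V \<subseteq> C" by (rule hull_minimal) (use VQ cone in \<open>auto simp: Q_def\<close>)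
    show "C \<subseteq> convex_cone hull V"
    proof
      fix x assume x: "x \<in> C"
      show "x \<in> convex_cone hull V"
      proof (cases "x = 0")
        case True then show ?thesis by (simp add: convex_cone_hull_contains_0)
      next
        case False
        have p: "0 < l \<bullet> x" by (rule lpos[OF x False])
        then have "(1 / (l \<bullet> x)) *\<^sub>R x \<in> Q" using convex_cone_scaleR[OF cone _ x] by (simp add: Q_def)
        then have "(1 / (l \<bullet> x)) *\<^sub>R x \<in> convex_cone hull V"
          unfolding QV using convex_hull_subset_convex_cone_hull by blast
        from convex_cone_hull_mul[OF this, of "l \<bullet> x"] show ?thesis using p by simp
      qed
    qed
  qed
  show thesis
  proof (rule that[of V l])
    show "finite V" unfolding V_def by (rule finite_polyhedron_extreme_points[OF Qp])
    show "C = convex_cone hull V" by (rule CV)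
    show "l \<bullet> v = 1" if "v \<in> V" for v using that VQ by (auto simp: Q_def)
    show "\<exists>e. e \<bullet> v = 0 \<and> (\<forall>w\<in>V. w \<noteq> v \<longrightarrow> 0 < e \<bullet> w)" if v: "v \<in> V" for v
    proof -
      have "{v} face_of Q" using v by (simp add: V_def face_of_singleton)
      then have "{v} exposed_face_of Q" using exposed_face_of_polyhedron[OF Qp] by simp
      then obtain c b where cb: "Q \<subseteq> {x. c \<bullet> x \<le> b}" "{v} = Q \<inter> {x. c \<bullet> x = b}"
        unfolding exposed_face_of_def by blast
      \<comment> \<open>As \<open>l = 1\<close> on the slice, \<open>b *\<^sub>R l - c\<close> is
        the linear form of the affine inequality that exposes \<open>v\<close>.\<close>
      have "(b *\<^sub>R l - c) \<bullet> v = 0" using cb(2) by (auto simp: Q_def inner_diff_left)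
      moreover have "0 < (b *\<^sub>R l - c) \<bullet> w" if w: "w \<in> V" "w \<noteq> v" for w
      proof -
        have "w \<in> Q" using w VQ by blast
        then have "c \<bullet> w \<le> b" "c \<bullet> w \<noteq> b" "l \<bullet> w = 1" using cb w(2) by (auto simp: Q_def)
        then show ?thesis by (simp add: inner_diff_left)
      qed
      ultimately show ?thesis by blast
    qed
  qed
qed

text \<open>Applying a facet functional \<open>f\<close> that misses \<open>v0\<close> to a linear
  relation involving \<open>v0\<close> shows that the facet misses a second generator
  \<open>w\<close>. With \<open>e0\<close>, \<open>e1\<close> exposing \<open>v0\<close>,
  \<open>w\<close>, the functional \<open>k = e1 - c f\<close> vanishes at \<open>v0\<close>, is
  nonnegative on the facet and negative at \<open>w\<close>. Tilting \<open>e0\<close> towards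
  \<open>k\<close> thus keeps the zero at \<open>v0\<close> and positivity on the facet until
  another generator becomes a zero.\<close>

lemma ex_disjoint_facet_and_face:
  fixes V :: "'a::euclidean_space set"
  assumes fin: "finite V" and sp: "span V = UNIV" and dep: "dependent V"
    and l: "\<And>v. v \<in> V \<Longrightarrow> 0 < l \<bullet> v"
    and expo: "\<And>v. v \<in> V \<Longrightarrow> \<exists>e. e \<bullet> v = 0 \<and> (\<forall>w\<in>V. w \<noteq> v \<longrightarrow> 0 < e \<bullet> w)"
  obtains f h v0 v1 where "\<And>v. v \<in> V \<Longrightarrow> 0 \<le> f \<bullet> v" "\<And>v. v \<in> V \<Longrightarrow> 0 \<le> h \<bullet> v"
    "\<And>v. v \<in> V \<Longrightarrow> f \<bullet> v = 0 \<Longrightarrow> 0 < h \<bullet> v"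
    "\<And>z. f \<bullet> z = 0 \<Longrightarrow> z \<in> span {v \<in> V. f \<bullet> v = 0}"
    "v0 \<in> V" "v1 \<in> V" "v0 \<noteq> v1" "h \<bullet> v0 = 0" "h \<bullet> v1 = 0"
proof -
  obtain u v0 where v0: "v0 \<in> V" "u v0 \<noteq> 0" and u: "(\<Sum>v\<in>V. u v *\<^sub>R v) = 0"
    using dep dependent_finite[OF fin] by blast
  have l': "\<And>v. v \<in> V \<Longrightarrow> 0 \<le> l \<bullet> v" using l by (simp add: less_imp_le)
  obtain f where f: "\<And>v. v \<in> V \<Longrightarrow> 0 \<le> f \<bullet> v" "0 < f \<bullet> v0"
    and facet: "\<And>z. f \<bullet> z = 0 \<Longrightarrow> z \<in> span {v \<in> V. f \<bullet> v = 0}"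
    using ex_facet_functional[OF fin sp v0(1) l' l[OF v0(1)]] by blast
  have "\<exists>v\<in>V. v \<noteq> v0 \<and> f \<bullet> v \<noteq> 0"
  proof (rule ccontr)
    assume "\<not> ?thesis"
    then have "(\<Sum>v\<in>V. u v * (f \<bullet> v)) = (\<Sum>v\<in>V. if v = v0 then u v0 * (f \<bullet> v0) else 0)"
      by (intro sum.cong) auto
    also have "\<dots> = u v0 * (f \<bullet> v0)" using fin v0(1) by simp
    finally have "f \<bullet> (\<Sum>v\<in>V. u v *\<^sub>R v) = u v0 * (f \<bullet> v0)" by (simp add: inner_sum_right)
    then show False using u v0(2) f(2) by simp
  qed
  then obtain w where w: "w \<in> V" "w \<noteq> v0" "f \<bullet> w \<noteq> 0" by blast
  obtain e0 where e0: "e0 \<bullet> v0 = 0" "\<And>v. v \<in> V \<Longrightarrow> v \<noteq> v0 \<Longrightarrow> 0 < e0 \<bullet> v"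
    using expo[OF v0(1)] by blast
  obtain e1 where e1: "e1 \<bullet> w = 0" "\<And>v. v \<in> V \<Longrightarrow> v \<noteq> w \<Longrightarrow> 0 < e1 \<bullet> v"
    using expo[OF w(1)] by blast
  define c where "c = (e1 \<bullet> v0) / (f \<bullet> v0)"
  have c: "0 < c" using e1(2)[OF v0(1)] w(2) f(2) by (simp add: c_def)
  define k where "k = e1 - c *\<^sub>R f"
  have kv0: "k \<bullet> v0 = 0" using f(2) by (simp add: k_def c_def inner_diff_left)
  have kw: "k \<bullet> w < 0" using c f(1)[OF w(1)] w(3) e1(1) by (simp add: k_def inner_diff_left)
  have e0nn: "\<And>v. v \<in> V \<Longrightarrow> 0 \<le> e0 \<bullet> v" using e0 by (metis less_imp_le order_refl)
  have e0pos: "\<And>v. v \<in> V \<Longrightarrow> k \<bullet> v < 0 \<Longrightarrow> 0 < e0 \<bullet> v" using e0(2) kv0 by force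
  obtain t v1 where t: "0 < t" "\<And>v. v \<in> V \<Longrightarrow> 0 \<le> (e0 + t *\<^sub>R k) \<bullet> v"
    and v1: "v1 \<in> V" "k \<bullet> v1 < 0" "(e0 + t *\<^sub>R k) \<bullet> v1 = 0"
    using pivot[OF fin w(1) kw e0nn e0pos] by blast
  show thesis
  proof (rule that[of f "e0 + t *\<^sub>R k" v0 v1])
    show "0 < (e0 + t *\<^sub>R k) \<bullet> v" if v: "v \<in> V" "f \<bullet> v = 0" for v
    proof -
      have "v \<noteq> v0" using v f(2) by auto
      then have "0 < e0 \<bullet> v" using e0 v by blast
      moreover have "0 \<le> e1 \<bullet> v" using e1 v(1) by (metis less_imp_le order_refl)
      then have "0 \<le> t * (k \<bullet> v)" using t v(2) by (simp add: k_def inner_diff_left)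
      ultimately show ?thesis unfolding inner_add_left inner_scaleR_left by linarith
    qed
    show "v0 \<noteq> v1" using kv0 v1(2) by auto
    show "(e0 + t *\<^sub>R k) \<bullet> v0 = 0" using kv0 e0(1) by (simp add: inner_add_left)
  qed (fact f(1) t(2) facet v0(1) v1)+
qed

text \<open>Because \<open>h \<bullet> z = 0\<close>, the coefficients of \<open>z\<close> with
  respect to the normalized generators sum to zero, so \<open>w\<close> can be subtracted from each
  of them. The affine hull is a linear span since \<open>w - w = 0\<close> is a difference.\<close>

lemma mem_affine_hull_differences:
  fixes S :: "'a::euclidean_space set"
  assumes pos: "\<And>v. v \<in> S \<Longrightarrow> 0 < h \<bullet> v" and z: "z \<in> span S" "h \<bullet> z = 0"
    and Q: "\<And>v. v \<in> S \<Longrightarrow> (1 / (h \<bullet> v)) *\<^sub>R v \<in> Q" "w \<in> Q"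
  shows "z \<in> affine hull {x - y | x y. x \<in> Q \<and> y \<in> Q}"
proof -
  let ?K = "{x - y | x y. x \<in> Q \<and> y \<in> Q}"
  have "w - w \<in> ?K" using Q(2) by blast
  then have "0 \<in> affine hull ?K" by (simp add: hull_inc)
  then have K: "affine hull ?K = span ?K" by (rule affine_hull_span_0)
  obtain T r where T: "finite T" "T \<subseteq> S" "z = (\<Sum>v\<in>T. r v *\<^sub>R v)"
    using z(1) unfolding span_explicit by blast
  have "(\<Sum>v\<in>T. r v * (h \<bullet> v)) = 0" using z(2) T(3) by (simp add: inner_sum_right)
  then have "(\<Sum>v\<in>T. (r v * (h \<bullet> v)) *\<^sub>R w) = 0" by (simp flip: scaleR_sum_left)
  then have "z = (\<Sum>v\<in>T. r v *\<^sub>R v - (r v * (h \<bullet> v)) *\<^sub>R w)"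
    by (simp add: sum_subtractf T(3))
  also have "\<dots> = (\<Sum>v\<in>T. (r v * (h \<bullet> v)) *\<^sub>R ((1 / (h \<bullet> v)) *\<^sub>R v - w))"
  proof (rule sum.cong)
    fix v assume "v \<in> T"
    then have "h \<bullet> v \<noteq> 0" using pos T(2) by force
    then show "r v *\<^sub>R v - (r v * (h \<bullet> v)) *\<^sub>R w = (r v * (h \<bullet> v)) *\<^sub>R ((1 / (h \<bullet> v)) *\<^sub>R v - w)"
      by (simp add: scaleR_diff_right)
  qed simp
  also have "\<dots> \<in> span ?K"
  proof (intro span_sum span_scale span_base)
    fix v assume "v \<in> T"
    then have "(1 / (h \<bullet> v)) *\<^sub>R v \<in> Q" using T(2) Q(1) by blast
    then show "(1 / (h \<bullet> v)) *\<^sub>R v - w \<in> ?K" using Q(2) by blast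
  qed
  finally show ?thesis using K by simp
qed

text \<open>The three functionals map the cone to \<open>\<real>\<^sup>3\<close> such that the four points lie on the disjoint edges
  \<open>h = 0\<close> and \<open>f = 0\<close> of the image.\<close>

lemma not_simplex_configuration:
  fixes C :: "'a::euclidean_space set"
  assumes cone: "convex_cone C" and poly: "polyhedral_cone C" and sal: "salient C"
    and int: "interior C \<noteq> {}" and ns: "\<not> simplex_cone C"
  obtains V f g h c1 c2 c3 c4 where "finite V" "C = convex_cone hull V"
    "c1 \<in> C" "c2 \<in> C" "c3 \<in> C" "c4 \<in> C" "c1 + c3 = c2 + c4"
    "f \<bullet> c1 = 1" "f \<bullet> c2 = 1" "f \<bullet> c3 = 0" "f \<bullet> c4 = 0"
    "h \<bullet> c1 = 0" "h \<bullet> c2 = 0" "h \<bullet> c3 = 1" "h \<bullet> c4 = 1"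
    "g \<bullet> c1 = 0" "g \<bullet> c2 = 1" "g \<bullet> c3 = 0" "g \<bullet> c4 = -1"
    "\<And>v. v \<in> V \<Longrightarrow> 0 \<le> f \<bullet> v" "\<And>v. v \<in> V \<Longrightarrow> 0 \<le> h \<bullet> v"
    "\<And>v. v \<in> V \<Longrightarrow> h \<bullet> v = 0 \<Longrightarrow> 0 \<le> g \<bullet> v \<and> g \<bullet> v \<le> f \<bullet> v"
    "\<And>v. v \<in> V \<Longrightarrow> f \<bullet> v = 0 \<Longrightarrow> - (h \<bullet> v) \<le> g \<bullet> v \<and> g \<bullet> v \<le> 0"
proof -
  obtain V l where fin: "finite V" and CV: "C = convex_cone hull V"
    and l: "\<And>v. v \<in> V \<Longrightarrow> l \<bullet> v = 1"
    and expo: "\<And>v. v \<in> V \<Longrightarrow> \<exists>e. e \<bullet> v = 0 \<and> (\<forall>w\<in>V. w \<noteq> v \<longrightarrow> 0 < e \<bullet> w)"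
    by (rule salient_polyhedral_cone_generators[OF cone poly sal]) blast
  have VC: "V \<subseteq> C" unfolding CV by (rule hull_subset)
  have "C \<subseteq> span V" unfolding CV by (rule hull_minimal) (auto simp: span_superset convex_cone_span)
  then have "interior (span V) \<noteq> {}" using interior_mono[OF \<open>C \<subseteq> span V\<close>] int by blast
  then have "\<not> dim (span V) < DIM('a)" using empty_interior_lowdim by blast
  then have dimV: "dim V = DIM('a)" using dim_subset_UNIV[of V] by (simp add: dim_span)
  then have sp: "span V = UNIV" by (simp add: dim_eq_full)
  have dep: "dependent V"
  proof (rule ccontr)
    assume "independent V"
    then have "card V = DIM('a)" using dimV dim_eq_card_independent by metis
    then show False using \<open>independent V\<close> CV ns unfolding simplex_cone_def by blast
  qed
  have l': "\<And>v. v \<in> V \<Longrightarrow> 0 < l \<bullet> v" using l by simp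
  obtain f h a b where f0: "\<And>v. v \<in> V \<Longrightarrow> 0 \<le> f \<bullet> v" and h0: "\<And>v. v \<in> V \<Longrightarrow> 0 \<le> h \<bullet> v"
    and hpos: "\<And>v. v \<in> V \<Longrightarrow> f \<bullet> v = 0 \<Longrightarrow> 0 < h \<bullet> v"
    and facet: "\<And>z. f \<bullet> z = 0 \<Longrightarrow> z \<in> span {v \<in> V. f \<bullet> v = 0}"
    and ab: "a \<in> V" "b \<in> V" "a \<noteq> b" "h \<bullet> a = 0" "h \<bullet> b = 0"
    by (rule ex_disjoint_facet_and_face[OF fin sp dep l' expo]) blast+
  define F where "F = {v \<in> V. f \<bullet> v = 0}"
  define E where "E = {v \<in> V. h \<bullet> v = 0}"
  \<comment> \<open>\<open>Q\<close> is the slice \<open>h = 1\<close> of the facet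
    \<open>f = 0\<close>, and \<open>Z\<close> consists of the differences of generators of the face
    \<open>h = 0\<close> scaled to \<open>f = 1\<close>.\<close>
  define Q where "Q = convex hull ((\<lambda>v. (1 / (h \<bullet> v)) *\<^sub>R v) ` F)"
  define d where "d v w = (1 / (f \<bullet> v)) *\<^sub>R v - (1 / (f \<bullet> w)) *\<^sub>R w" for v w
  define Z where "Z = (\<lambda>(v, w). d v w) ` (E \<times> E)"
  have fE: "0 < f \<bullet> v" if "v \<in> E" for v
    using that hpos[of v] f0[of v] by (force simp: E_def)
  have hF: "0 < h \<bullet> v" if "v \<in> F" for v using that hpos by (auto simp: F_def)
  have Fspan: "z \<in> span F" if "f \<bullet> z = 0" for z unfolding F_def by (rule facet[OF that])
  have fd: "f \<bullet> d v w = 0" and hd: "h \<bullet> d v w = 0" if "v \<in> E" "w \<in> E" for v w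
    using that fE[OF that(1)] fE[OF that(2)] by (auto simp: d_def inner_diff_right E_def)
  have abE: "a \<in> E" "b \<in> E" using ab by (auto simp: E_def)
  have ab0: "d a b \<noteq> 0"
  proof
    assume "d a b = 0"
    then have eq: "(1 / (f \<bullet> a)) *\<^sub>R a = (1 / (f \<bullet> b)) *\<^sub>R b" by (simp add: d_def)
    then have "l \<bullet> ((1 / (f \<bullet> a)) *\<^sub>R a) = l \<bullet> ((1 / (f \<bullet> b)) *\<^sub>R b)" by simp
    then have "1 / (f \<bullet> a) = 1 / (f \<bullet> b)" using l ab by simp
    then have "a = b" using eq fE[OF abE(1)] by simp
    then show False using ab by simp
  qed
  have QI: "(1 / (h \<bullet> v)) *\<^sub>R v \<in> Q" if "v \<in> F" for v unfolding Q_def using that by (intro hull_inc) auto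
  have "F \<noteq> {}" using Fspan[OF fd[OF abE]] ab0 by auto
  then obtain w0 where w0: "w0 \<in> Q" using QI by blast
  have cptQ: "compact Q" unfolding Q_def using fin by (intro finite_imp_compact_convex_hull) (simp add: F_def)
  have cvxQ: "convex Q" unfolding Q_def by (rule convex_convex_hull)
  have hQ: "h \<bullet> q = 1" and fQ: "f \<bullet> q = 0" and QC: "q \<in> C" if "q \<in> Q" for q
  proof -
    have "Q \<subseteq> {x. h \<bullet> x = 1} \<inter> {x. f \<bullet> x = 0} \<inter> C" unfolding Q_def
    proof (rule hull_minimal)
      show "convex ({x. h \<bullet> x = 1} \<inter> {x. f \<bullet> x = 0} \<inter> C)"
        using cone by (intro convex_Int convex_hyperplane) (simp add: convex_cone_def)
      show "(\<lambda>v. (1 / (h \<bullet> v)) *\<^sub>R v) ` F \<subseteq> {x. h \<bullet> x = 1} \<inter> {x. f \<bullet> x = 0} \<inter> C"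
      proof
        fix x assume "x \<in> (\<lambda>v. (1 / (h \<bullet> v)) *\<^sub>R v) ` F"
        then obtain v where v: "v \<in> F" "x = (1 / (h \<bullet> v)) *\<^sub>R v" by blast
        have "v \<in> C" "f \<bullet> v = 0" using v(1) VC by (auto simp: F_def)
        then show "x \<in> {x. h \<bullet> x = 1} \<inter> {x. f \<bullet> x = 0} \<inter> C"
          using hF[OF v(1)] v(2) convex_cone_scaleR[OF cone] by simp
      qed
    qed
    then show "h \<bullet> q = 1" "f \<bullet> q = 0" "q \<in> C" using that by blast+
  qed
  have finZ: "finite Z" unfolding Z_def E_def using fin by simp
  have dZ: "d a b \<in> Z" unfolding Z_def using abE by force
  \<comment> \<open>This is where a facet is needed: the directions \<open>d v w\<close> lie in the
    kernel of \<open>f\<close>, which the facet spans, so they are parallel to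
    \<open>Q\<close>.\<close>
  have affZ: "z \<in> affine hull {x - y | x y. x \<in> Q \<and> y \<in> Q}" if z: "z \<in> Z" for z
  proof -
    obtain v w where vw: "v \<in> E" "w \<in> E" "z = d v w" using z by (auto simp: Z_def)
    show ?thesis unfolding vw(3)
      by (rule mem_affine_hull_differences[OF hF Fspan[OF fd[OF vw(1,2)]] hd[OF vw(1,2)] QI w0])
  qed
  have Qne: "Q \<noteq> {}" using w0 by blast
  obtain t z x y p where t: "0 < t" and z: "z \<in> Z" and xy: "x \<in> Q" "y \<in> Q" "t *\<^sub>R z = x - y"
    and pz: "0 < p \<bullet> z" and pxy: "\<forall>q\<in>Q. p \<bullet> y \<le> p \<bullet> q \<and> p \<bullet> q \<le> p \<bullet> x"
    and pmax: "\<forall>z'\<in>Z. p \<bullet> z' \<le> p \<bullet> z"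
    using supporting_chord[OF cptQ cvxQ Qne finZ dZ ab0 affZ] by blast
  obtain v w where vw: "v \<in> E" "w \<in> E" and zd: "z = d v w" using z by (auto simp: Z_def)
  \<comment> \<open>The width of \<open>Q\<close> in the direction \<open>p\<close>; up to the
    factor \<open>t\<close> it is also the width of the normalized face, since
    \<open>t z = x - y\<close> is extremal for both.\<close>
  define m where "m = t * (p \<bullet> z)"
  have m: "0 < m" "p \<bullet> x - p \<bullet> y = m"
  proof -
    show "0 < m" using t pz by (simp add: m_def)
    show "p \<bullet> x - p \<bullet> y = m" using arg_cong[OF xy(3), of "\<lambda>x. p \<bullet> x"] by (simp add: m_def inner_diff_right)
  qed
  define r where "r = (p \<bullet> v) / (f \<bullet> v)"
  define psi where "psi = (1 / m) *\<^sub>R (p - (p \<bullet> y) *\<^sub>R h)"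
  define f' where "f' = (1 / t) *\<^sub>R f"
  \<comment> \<open>On the face, \<open>g\<close> measures how far \<open>p / f\<close> lies below
    its maximum \<open>r\<close>; on the facet it is minus the height of \<open>p\<close> above
    \<open>p \<bullet> y\<close>. Division by the width \<open>m\<close> turns the two ranges into
    \<open>[0, f']\<close> and \<open>[-h, 0]\<close>.\<close>
  define g where "g = (r / m) *\<^sub>R f - psi"
  define c1 where "c1 = (t / (f \<bullet> v)) *\<^sub>R v"
  define c2 where "c2 = (t / (f \<bullet> w)) *\<^sub>R w"
  note fv = fE[OF vw(1)] and fw = fE[OF vw(2)]
  have pzd: "p \<bullet> z = r - (p \<bullet> w) / (f \<bullet> w)" by (simp add: zd d_def inner_diff_right r_def)
  have hv: "h \<bullet> v = 0" "h \<bullet> w = 0" "v \<in> V" "w \<in> V" using vw by (auto simp: E_def)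
  have pE: "(p \<bullet> u) / (f \<bullet> u) \<le> r" "r - (p \<bullet> u) / (f \<bullet> u) \<le> p \<bullet> z" if "u \<in> E" for u
  proof -
    have "d u w \<in> Z" "d v u \<in> Z" unfolding Z_def using that vw by force+
    then have "p \<bullet> d u w \<le> p \<bullet> z" "p \<bullet> d v u \<le> p \<bullet> z" using pmax by blast+
    then show "(p \<bullet> u) / (f \<bullet> u) \<le> r" "r - (p \<bullet> u) / (f \<bullet> u) \<le> p \<bullet> z"
      unfolding pzd by (simp_all add: d_def inner_diff_right r_def)
  qed
  have gE: "g \<bullet> u = (f \<bullet> u) / m * (r - (p \<bullet> u) / (f \<bullet> u))" if "u \<in> E" for u
  proof -
    have "h \<bullet> u = 0" using that by (simp add: E_def)
    then show ?thesis unfolding g_def psi_def inner_diff_left inner_scaleR_left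
      using fE[OF that] m(1) by (simp add: field_simps)
  qed
  have gQ: "g \<bullet> u = - ((p \<bullet> u - (p \<bullet> y) * (h \<bullet> u)) / m)" if "f \<bullet> u = 0" for u
    using that by (simp add: g_def psi_def inner_diff_left)
  show thesis
  proof (rule that[of V c1 c2 y x f' h g])
    show "c1 \<in> C" "c2 \<in> C" unfolding c1_def c2_def using t fv fw hv VC
      by (auto intro!: convex_cone_scaleR[OF cone])
    show "y \<in> C" "x \<in> C" using QC xy by blast+
    have "c1 - c2 = t *\<^sub>R z" by (simp add: c1_def c2_def zd d_def scaleR_diff_right)
    then show "c1 + y = c2 + x" using xy(3) by (simp add: algebra_simps)
    show "f' \<bullet> c1 = 1" "f' \<bullet> c2 = 1" using t fv fw by (simp_all add: f'_def c1_def c2_def)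
    show "f' \<bullet> y = 0" "f' \<bullet> x = 0" "h \<bullet> y = 1" "h \<bullet> x = 1" using fQ hQ xy by (simp_all add: f'_def)
    show "h \<bullet> c1 = 0" "h \<bullet> c2 = 0" using hv by (simp_all add: c1_def c2_def)
    show "g \<bullet> c1 = 0" using gE[OF vw(1)] by (simp add: c1_def r_def)
    have "g \<bullet> c2 = t * (r - (p \<bullet> w) / (f \<bullet> w)) / m"
      using gE[OF vw(2)] fw by (simp add: c2_def)
    then have "g \<bullet> c2 = m / m" by (simp add: m_def pzd)
    then show "g \<bullet> c2 = 1" using m(1) by simp
    show "g \<bullet> y = 0" "g \<bullet> x = -1" using gQ[OF fQ] hQ xy(1,2) m by simp_all
    show "0 \<le> f' \<bullet> u" if "u \<in> V" for u using f0[OF that] t by (simp add: f'_def)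
    show "0 \<le> g \<bullet> u \<and> g \<bullet> u \<le> f' \<bullet> u" if "u \<in> V" "h \<bullet> u = 0" for u
    proof -
      have u: "u \<in> E" using that by (simp add: E_def)
      have fu: "0 < (f \<bullet> u) / m" using fE[OF u] m(1) by simp
      have "g \<bullet> u \<le> (f \<bullet> u) / m * (p \<bullet> z)"
        unfolding gE[OF u] using pE(2)[OF u] fu by (intro mult_left_mono) auto
      also have "\<dots> = f' \<bullet> u" using pz t by (simp add: m_def f'_def)
      finally show ?thesis unfolding gE[OF u] using pE(1)[OF u] fu
        by (intro conjI mult_nonneg_nonneg) auto
    qed
    show "- (h \<bullet> u) \<le> g \<bullet> u \<and> g \<bullet> u \<le> 0" if "u \<in> V" "f' \<bullet> u = 0" for u
    proof -
      have u: "u \<in> F" "f \<bullet> u = 0" using that t by (simp_all add: F_def f'_def)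
      note hu = hF[OF u(1)]
      have "(p \<bullet> y) * (h \<bullet> u) \<le> p \<bullet> u" "p \<bullet> u \<le> (p \<bullet> x) * (h \<bullet> u)"
        using bspec[OF pxy QI[OF u(1)]] hu by (simp_all add: field_simps)
      then have "0 \<le> p \<bullet> u - (p \<bullet> y) * (h \<bullet> u)" "p \<bullet> u - (p \<bullet> y) * (h \<bullet> u) \<le> (h \<bullet> u) * m"
        unfolding m(2)[symmetric] by (simp_all add: right_diff_distrib mult.commute)
      then show ?thesis unfolding gQ[OF u(2)] using m(1) by (simp add: pos_divide_le_eq)
    qed
    show "finite V" "C = convex_cone hull V" by (fact fin CV)+
    show "0 \<le> h \<bullet> u" if "u \<in> V" for u by (rule h0[OF that])
  qed
qed

section \<open>Pencils of positive semidefinite forms\<close>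

text \<open>This makes \<open>span\<close> and \<open>linear\<close> available for vectors encoded
  as functions \<open>nat \<Rightarrow> complex\<close>.\<close>

instantiation "fun" :: (type, real_vector) real_vector
begin

definition scaleR_fun :: "real \<Rightarrow> ('a \<Rightarrow> 'b) \<Rightarrow> 'a \<Rightarrow> 'b" where
  "scaleR_fun c f = (\<lambda>x. c *\<^sub>R f x)"

instance
  by standard (auto simp: scaleR_fun_def plus_fun_def scaleR_add_right scaleR_add_left)

end

text \<open>The real part of a positive Hermitian form is of this kind over the reals. Linearity in
  the second argument comes from symmetry; degenerate forms and infinite dimension are
  allowed.\<close>

definition psd_bilinear :: "('v::real_vector \<Rightarrow> 'v \<Rightarrow> real) \<Rightarrow> bool" where
  "psd_bilinear B \<longleftrightarrow> (\<forall>x y z. B (x + y) z = B x z + B y z) \<and> (\<forall>c x y. B (c *\<^sub>R x) y = c * B x y) \<and>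
     (\<forall>x y. B x y = B y x) \<and> (\<forall>x. 0 \<le> B x x)"

lemma psd_bilinearI:
  assumes "\<And>x y z. B (x + y) z = B x z + B y z" "\<And>c x y. B (c *\<^sub>R x) y = c * B x y"
    "\<And>x y. B x y = B y x" "\<And>x. 0 \<le> B x x"
  shows "psd_bilinear B"
  using assms unfolding psd_bilinear_def by blast

lemma psd_bilinearD:
  assumes "psd_bilinear B"
  shows "B (x + y) z = B x z + B y z" "B z (x + y) = B z x + B z y"
    "B (c *\<^sub>R x) y = c * B x y" "B y (c *\<^sub>R x) = c * B y x" "0 \<le> B x x"
    "B (x - y) z = B x z - B y z" "B z (x - y) = B z x - B z y" "B 0 z = 0"
proof -
  have A: "B (x + y) z = B x z + B y z" "B (c *\<^sub>R x) y = c * B x y" "B x y = B y x" "0 \<le> B x x"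
    for x y z c using assms unfolding psd_bilinear_def by blast+
  show "B (x + y) z = B x z + B y z" "B z (x + y) = B z x + B z y"
    "B (c *\<^sub>R x) y = c * B x y" "B y (c *\<^sub>R x) = c * B y x" "0 \<le> B x x"
    using A by metis+
  show "B (x - y) z = B x z - B y z" for x y z
    using A(1)[of "x - y" y z] by simp
  then show "B z (x - y) = B z x - B z y" using A(3) by metis
  show "B 0 z = 0" using A(2)[of 0 0 z] by simp
qed

lemma psd_bilinear_sum_left:
  assumes "psd_bilinear B"
  shows "B (\<Sum>i\<in>I. c i *\<^sub>R f i) y = (\<Sum>i\<in>I. c i * B (f i) y)"
  by (induction I rule: infinite_finite_induct) (simp_all add: psd_bilinearD[OF assms])

text \<open>For null \<open>v\<close> the value at \<open>y + t *\<^sub>R v\<close> is affine in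
  \<open>t\<close> with slope \<open>2 * B v y\<close>; a nonzero slope would allow the value
  \<open>-1\<close>.\<close>

lemma psd_bilinear_kernel:
  assumes B: "psd_bilinear B" and v: "B v v = 0"
  shows "B v y = 0"
proof (rule ccontr)
  assume ne: "B v y \<noteq> 0"
  have sym: "B y v = B v y" using B unfolding psd_bilinear_def by blast
  define t where "t = - (B y y + 1) / (2 * B v y)"
  have "0 \<le> B (y + t *\<^sub>R v) (y + t *\<^sub>R v)" by (rule psd_bilinearD(5)[OF B])
  also have "\<dots> = B y y + 2 * t * B v y" by (simp add: psd_bilinearD[OF B] v sym)
  also have "\<dots> = -1" using ne by (simp add: t_def field_simps)
  finally show False by simp
qed

lemma psd_bilinear_compose:
  assumes "psd_bilinear B" "linear f"
  shows "psd_bilinear (\<lambda>x y. B (f x) (f y))"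
proof (rule psd_bilinearI)
  show "B (f x) (f y) = B (f y) (f x)" for x y using assms(1) unfolding psd_bilinear_def by blast
qed (simp_all add: psd_bilinearD[OF assms(1)] linear_add[OF assms(2)] linear_scale[OF assms(2)])

lemma psd_bilinear_add:
  assumes "psd_bilinear B" "psd_bilinear B'"
  shows "psd_bilinear (\<lambda>x y. B x y + B' x y)"
proof (rule psd_bilinearI)
  show "B x y + B' x y = B y x + B' y x" for x y using assms unfolding psd_bilinear_def by metis
qed (simp_all add: psd_bilinearD[OF assms(1)] psd_bilinearD[OF assms(2)] distrib_left)

text \<open>Induction on the generators. A generator that is null for \<open>B1\<close> is null for
  both forms and affects neither; any other is split off by the \<open>B1\<close>-orthogonal
  projection. The factors 2 in the new constant come from bounding the \<open>B2\<close>-value of a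
  sum by twice the sum of the values.\<close>

lemma psd_bilinear_dominated:
  fixes B1 B2 :: "'v::real_vector \<Rightarrow> 'v \<Rightarrow> real"
  assumes "finite S" "psd_bilinear B1" "psd_bilinear B2"
    and "\<And>x. x \<in> span S \<Longrightarrow> B1 x x = 0 \<Longrightarrow> B2 x x = 0"
  shows "\<exists>K\<ge>0. \<forall>x\<in>span S. B2 x x \<le> K * B1 x x"
  using assms
proof (induction S arbitrary: B1 B2 rule: finite_induct)
  case empty
  then show ?case by (intro exI[of _ 0]) (simp add: psd_bilinearD)
next
  case (insert v S)
  note B1 = insert.prems(1) and B2 = insert.prems(2) and ker = insert.prems(3)
  note D1 = psd_bilinearD[OF B1] and D2 = psd_bilinearD[OF B2]
  have vS: "v \<in> span (insert v S)" and sub: "span S \<subseteq> span (insert v S)"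
    by (auto intro: span_base span_mono[THEN subsetD])
  show ?case
  proof (cases "B1 v v = 0")
    case True
    then have "B2 v v = 0" using ker[OF vS] by blast
    have k1: "B1 (x + k *\<^sub>R v) (x + k *\<^sub>R v) = B1 x x" and k2: "B2 (x + k *\<^sub>R v) (x + k *\<^sub>R v) = B2 x x" for x k
    proof -
      have "B1 x v = 0" "B1 v x = 0" "B2 x v = 0" "B2 v x = 0"
        using psd_bilinear_kernel[OF B1 True] psd_bilinear_kernel[OF B2 \<open>B2 v v = 0\<close>] B1 B2
        unfolding psd_bilinear_def by metis+
      then show "B1 (x + k *\<^sub>R v) (x + k *\<^sub>R v) = B1 x x" "B2 (x + k *\<^sub>R v) (x + k *\<^sub>R v) = B2 x x"
        using True \<open>B2 v v = 0\<close> by (simp_all add: D1 D2)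
    qed
    obtain K where K: "K \<ge> 0" "\<forall>x\<in>span S. B2 x x \<le> K * B1 x x"
      using insert.IH[OF B1 B2] ker sub by blast
    have "B2 x x \<le> K * B1 x x" if x: "x \<in> span (insert v S)" for x
    proof -
      obtain k where "x - k *\<^sub>R v \<in> span S" using x span_breakdown_eq by blast
      then show ?thesis using K(2) k1[of "x - k *\<^sub>R v" k] k2[of "x - k *\<^sub>R v" k] by force
    qed
    then show ?thesis using K(1) by blast
  next
    case False
    then have p: "0 < B1 v v" using D1(5)[of v] by simp
    define f where "f x = x - (B1 x v / B1 v v) *\<^sub>R v" for x
    have f: "linear f" unfolding f_def
      by (intro linearI) (simp_all add: D1 add_divide_distrib algebra_simps)
    have fv: "f v = 0" using p by (simp add: f_def)
    have fspan: "f x \<in> span (insert v S)" if "x \<in> span S" for x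
      unfolding f_def using that sub vS by (intro span_diff span_scale) auto
    obtain K where K: "K \<ge> 0" "\<forall>x\<in>span S. B2 (f x) (f x) \<le> K * B1 (f x) (f x)"
      using insert.IH[OF psd_bilinear_compose[OF B1 f] psd_bilinear_compose[OF B2 f]] ker fspan by blast
    define K' where "K' = 2 * K + 2 * (B2 v v / B1 v v)"
    have "B2 x x \<le> K' * B1 x x" if x: "x \<in> span (insert v S)" for x
    proof -
      obtain k where k: "x - k *\<^sub>R v \<in> span S" using x span_breakdown_eq by blast
      define c where "c = B1 x v / B1 v v"
      have sym: "B1 v x = B1 x v" using B1 unfolding psd_bilinear_def by blast
      have "f (x - k *\<^sub>R v) = f x" using fv by (simp add: linear_diff[OF f] linear_scale[OF f])
      then have fx: "B2 (f x) (f x) \<le> K * B1 (f x) (f x)" using K(2) k by metis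
      have B1f: "B1 (f x) (f x) = B1 x x - c\<^sup>2 * B1 v v"
        using p unfolding f_def c_def by (simp add: D1 sym power2_eq_square field_simps)
      have xf: "x = f x + c *\<^sub>R v" by (simp add: f_def c_def)
      have "0 \<le> B2 (f x - c *\<^sub>R v) (f x - c *\<^sub>R v)" by (rule D2(5))
      then have "B2 (f x + c *\<^sub>R v) (f x + c *\<^sub>R v) \<le> 2 * B2 (f x) (f x) + 2 * c\<^sup>2 * B2 v v"
        by (simp add: D2 power2_eq_square algebra_simps)
      then have "B2 x x \<le> 2 * B2 (f x) (f x) + 2 * c\<^sup>2 * B2 v v" using xf by simp
      also have "\<dots> \<le> 2 * (K * B1 x x) + 2 * (B2 v v / B1 v v) * B1 x x"
      proof -
        have "0 \<le> B1 (f x) (f x)" by (rule D1(5))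
        then have c: "c\<^sup>2 * B1 v v \<le> B1 x x" using B1f by simp
        have "0 \<le> c\<^sup>2 * B1 v v" using p by simp
        then have "K * B1 (f x) (f x) \<le> K * B1 x x" using K(1) B1f by (intro mult_left_mono) auto
        moreover have "(B2 v v / B1 v v) * (c\<^sup>2 * B1 v v) \<le> (B2 v v / B1 v v) * B1 x x"
          using c p D2(5)[of v] by (intro mult_left_mono) auto
        then have "c\<^sup>2 * B2 v v \<le> (B2 v v / B1 v v) * B1 x x" using p by (simp add: mult.commute)
        ultimately show ?thesis using fx by linarith
      qed
      finally show ?thesis by (simp add: K'_def algebra_simps)
    qed
    moreover have "0 \<le> K'" unfolding K'_def using K(1) p D2(5)[of v] by simp
    ultimately show ?thesis by blast
  qed
qed

text \<open>A relation modulo the kernel of \<open>M\<close> between the vectors \<open>a s\<close> remains a relation after its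
  coefficients are multiplied by \<open>1 - s\<close>; Lagrange interpolation then isolates one coefficient.\<close>

lemma pencil_eigenvectors_independent:
  fixes a b :: "real \<Rightarrow> 'v::real_vector"
  assumes B1: "psd_bilinear B1" and B2: "psd_bilinear B2" and M: "psd_bilinear M"
    and ker: "\<And>x. M x x = 0 \<Longrightarrow> B1 x x = 0" "\<And>x. M x x = 0 \<Longrightarrow> B2 x x = 0"
    and a1: "\<And>s y. s \<in> J \<Longrightarrow> B1 (a s) y = M (a s) y" and b1: "\<And>s y. s \<in> J \<Longrightarrow> B1 (b s) y = 0"
    and a2: "\<And>s y. s \<in> J \<Longrightarrow> B2 (a s) y = (1 - s) * M (a s + s *\<^sub>R b s) y"
    and ne: "\<And>s. s \<in> J \<Longrightarrow> M (a s) (a s) \<noteq> 0"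
    and fin: "finite J" and rel: "(\<Sum>s\<in>J. c s *\<^sub>R a s) = 0" and s0: "s0 \<in> J"
  shows "c s0 = 0"
proof -
  define N where "N g \<longleftrightarrow> (\<forall>y. (\<Sum>s\<in>J. g s * M (a s) y) = 0)" for g
  have ker': "B y z = 0" if "psd_bilinear B" "\<And>x. M x x = 0 \<Longrightarrow> B x x = 0" "\<And>z. M y z = 0" for B y z
    using psd_bilinear_kernel[OF that(1), of y z] that(2)[of y] that(3) by blast
  \<comment> \<open>\<open>B2\<close> turns the relation between the \<open>a s\<close> into one
    between the \<open>(1 - s) *\<^sub>R (a s + s *\<^sub>R b s)\<close> under \<open>M\<close>;
    then \<open>B1\<close> removes the \<open>b s\<close> and returns the \<open>a s\<close> under
    \<open>M\<close>.\<close>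
  have step: "N (\<lambda>s. (1 - s) * g s)" if g: "N g" for g
  proof -
    let ?x = "\<Sum>s\<in>J. g s *\<^sub>R a s" and ?y = "\<Sum>s\<in>J. ((1 - s) * g s) *\<^sub>R (a s + s *\<^sub>R b s)"
    have "M ?x y = 0" for y using g by (simp add: N_def psd_bilinear_sum_left[OF M])
    then have "B2 ?x y = 0" for y using ker'[OF B2 ker(2)] by blast
    then have "(\<Sum>s\<in>J. g s * B2 (a s) y) = 0" for y by (simp add: psd_bilinear_sum_left[OF B2])
    moreover have "(\<Sum>s\<in>J. g s * B2 (a s) y) = M ?y y" for y
      unfolding psd_bilinear_sum_left[OF M] by (intro sum.cong) (simp_all add: a2)
    ultimately have "M ?y y = 0" for y by simp
    then have "B1 ?y y = 0" for y using ker'[OF B1 ker(1)] by blast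
    moreover have "B1 ?y y = (\<Sum>s\<in>J. (1 - s) * g s * M (a s) y)" for y
      unfolding psd_bilinear_sum_left[OF B1]
      by (intro sum.cong) (simp_all add: psd_bilinearD[OF B1] a1 b1)
    ultimately show ?thesis by (simp add: N_def)
  qed
  have diff: "N (\<lambda>s. (r - s) * g s)" if g: "N g" for g r
  proof -
    have "(\<Sum>s\<in>J. ((r - s) * g s) * M (a s) y) =
      (\<Sum>s\<in>J. ((1 - s) * g s) * M (a s) y) + (r - 1) * (\<Sum>s\<in>J. g s * M (a s) y)" for y
      by (simp add: sum_distrib_left algebra_simps flip: sum.distrib)
    then show ?thesis using step[OF g] g by (simp add: N_def)
  qed
  have "N c"
  proof -
    have "M (\<Sum>s\<in>J. c s *\<^sub>R a s) y = 0" for y using rel by (simp add: psd_bilinearD[OF M])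
    then show ?thesis by (simp add: N_def psd_bilinear_sum_left[OF M])
  qed
  have "N (\<lambda>s. (\<Prod>r\<in>R. r - s) * c s)" if "finite R" for R
    using that
  proof (induction R)
    case empty then show ?case using \<open>N c\<close> by simp
  next
    case (insert r R)
    then show ?case using diff[OF insert.IH, of r] by (simp add: mult.assoc)
  qed
  from this[of "J - {s0}"] have "(\<Sum>s\<in>J. (\<Prod>r\<in>J - {s0}. r - s) * c s * M (a s) (a s0)) = 0"
    using fin by (simp add: N_def)
  also have "(\<Sum>s\<in>J. (\<Prod>r\<in>J - {s0}. r - s) * c s * M (a s) (a s0)) =
    (\<Sum>s\<in>J. if s = s0 then (\<Prod>r\<in>J - {s0}. r - s0) * c s0 * M (a s0) (a s0) else 0)"
  proof (rule sum.cong)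
    fix s assume s: "s \<in> J"
    have "(\<Prod>r\<in>J - {s0}. r - s) = 0" if "s \<noteq> s0" using fin s that by (intro prod_zero) auto
    then show "(\<Prod>r\<in>J - {s0}. r - s) * c s * M (a s) (a s0) =
      (if s = s0 then (\<Prod>r\<in>J - {s0}. r - s0) * c s0 * M (a s0) (a s0) else 0)" by simp
  qed simp
  also have "\<dots> = (\<Prod>r\<in>J - {s0}. r - s0) * c s0 * M (a s0) (a s0)" using fin s0 by simp
  finally show ?thesis using ne[OF s0] fin by simp
qed

text \<open>With forms read as operators and \<open>M = B1 + B3 = B2 + B4\<close>, the conditions
  become \<open>B1 b = 0\<close>, \<open>B1 a = M a\<close> and
  \<open>B2 a = (1 - s) M (a + s b)\<close>. Eliminating \<open>b\<close> gives, formally, the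
  eigenvalue equation \<open>M^-1 B1 M^-1 B2 a = (1 - s) a\<close>. Eigenvectors for distinct
  \<open>s\<close> are independent, and all lie in the finite-dimensional
  \<open>span S\<close>.\<close>

lemma finite_pencil_spectrum:
  fixes B1 B2 B3 B4 :: "'v::real_vector \<Rightarrow> 'v \<Rightarrow> real"
  assumes B: "psd_bilinear B1" "psd_bilinear B2" "psd_bilinear B3" "psd_bilinear B4"
    and eq: "\<And>x y. B1 x y + B3 x y = B2 x y + B4 x y"
    and S: "finite S" and I: "\<And>s. s \<in> I \<Longrightarrow> \<exists>a\<in>span S. \<exists>b. B1 b b = 0 \<and> B3 a a = 0 \<and>
      B2 (a + (s - 1) *\<^sub>R b) (a + (s - 1) *\<^sub>R b) = 0 \<and> B4 (a + s *\<^sub>R b) (a + s *\<^sub>R b) = 0 \<and>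
      B1 a a + B3 a a + (B1 b b + B3 b b) \<noteq> 0"
    and I0: "0 \<notin> I" "1 \<notin> I"
  shows "finite I"
proof -
  define M where "M x y = B1 x y + B3 x y" for x y
  have M: "psd_bilinear M" unfolding M_def[abs_def] by (rule psd_bilinear_add[OF B(1,3)])
  have M24: "M x y = B2 x y + B4 x y" for x y by (simp add: M_def eq)
  note D = psd_bilinearD[OF B(1)] psd_bilinearD[OF B(2)] psd_bilinearD[OF B(3)] psd_bilinearD[OF B(4)]
    psd_bilinearD[OF M]
  have ker1: "B1 x x = 0" if "M x x = 0" for x
    using that psd_bilinearD(5)[OF B(1), of x] psd_bilinearD(5)[OF B(3), of x] unfolding M_def by linarith
  have ker2: "B2 x x = 0" if "M x x = 0" for x
    using that psd_bilinearD(5)[OF B(2), of x] psd_bilinearD(5)[OF B(4), of x] unfolding M24 by linarith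
  from I have "\<forall>s\<in>I. \<exists>p. fst p \<in> span S \<and> B1 (snd p) (snd p) = 0 \<and> B3 (fst p) (fst p) = 0 \<and>
      B2 (fst p + (s - 1) *\<^sub>R snd p) (fst p + (s - 1) *\<^sub>R snd p) = 0 \<and>
      B4 (fst p + s *\<^sub>R snd p) (fst p + s *\<^sub>R snd p) = 0 \<and>
      B1 (fst p) (fst p) + B3 (fst p) (fst p) + (B1 (snd p) (snd p) + B3 (snd p) (snd p)) \<noteq> 0" by force
  from bchoice[OF this] obtain p where p: "\<And>s. s \<in> I \<Longrightarrow> fst (p s) \<in> span S \<and> B1 (snd (p s)) (snd (p s)) = 0 \<and>
      B3 (fst (p s)) (fst (p s)) = 0 \<and>
      B2 (fst (p s) + (s - 1) *\<^sub>R snd (p s)) (fst (p s) + (s - 1) *\<^sub>R snd (p s)) = 0 \<and>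
      B4 (fst (p s) + s *\<^sub>R snd (p s)) (fst (p s) + s *\<^sub>R snd (p s)) = 0 \<and>
      B1 (fst (p s)) (fst (p s)) + B3 (fst (p s)) (fst (p s)) + (B1 (snd (p s)) (snd (p s)) + B3 (snd (p s)) (snd (p s))) \<noteq> 0"
    by blast
  define a where "a s = fst (p s)" for s
  define b where "b s = snd (p s)" for s
  note p = p[folded a_def b_def]
  have b1: "B1 (b s) y = 0" and a3: "B3 (a s) y = 0" and ab2: "B2 (a s + (s - 1) *\<^sub>R b s) y = 0"
    and ab4: "B4 (a s + s *\<^sub>R b s) y = 0" if "s \<in> I" for s y
    using p[OF that] B psd_bilinear_kernel by blast+
  have a1: "B1 (a s) y = M (a s) y" if "s \<in> I" for s y using a3[OF that] by (simp add: M_def)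
  \<comment> \<open>\<open>B2 a = (1 - s) B2 b\<close> by \<open>ab2\<close>, while
    \<open>ab4\<close> makes \<open>M\<close> and \<open>B2\<close> agree on \<open>a + s b\<close>;
    there \<open>B2\<close> has the value \<open>(1 - s) B2 b + s B2 b\<close>.\<close>
  have b2: "B2 (b s) y = M (a s + s *\<^sub>R b s) y" if "s \<in> I" for s y
    using ab2[OF that, of y] ab4[OF that, of y] unfolding M24 by (simp add: D algebra_simps)
  have a2: "B2 (a s) y = (1 - s) * M (a s + s *\<^sub>R b s) y" if "s \<in> I" for s y
    using ab2[OF that, of y] b2[OF that, of y] by (simp add: D algebra_simps)
  \<comment> \<open>If \<open>a s\<close> were null for \<open>M\<close>, the relations would leave
    \<open>(s - 1) * s * M (b s) y = 0\<close>. As \<open>s\<close> is neither 0 nor 1,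
    \<open>b s\<close> would be null too, against the last condition on the pair.\<close>
  have ne: "M (a s) (a s) \<noteq> 0" if s: "s \<in> I" for s
  proof
    assume a0: "M (a s) (a s) = 0"
    then have Ma: "M (a s) y = 0" for y by (rule psd_bilinear_kernel[OF M])
    have "B2 (a s) y = 0" for y by (rule psd_bilinear_kernel[OF B(2) ker2[OF a0]])
    moreover have "B2 (b s) y = M (a s + s *\<^sub>R b s) y" for y by (rule b2[OF s])
    moreover have "B2 (a s + (s - 1) *\<^sub>R b s) y = 0" for y by (rule ab2[OF s])
    ultimately have *: "(s - 1) * (s * M (b s) y) = 0" for y by (simp add: D Ma)
    have "s \<noteq> 0" "s \<noteq> 1" using I0 s by auto
    then have "M (b s) (b s) = 0" using *[of "b s"] by simp
    then show False using p[OF s] a0 by (simp add: M_def)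
  qed
  have indep: "c s = 0" if "finite J" "J \<subseteq> I" "(\<Sum>s\<in>J. c s *\<^sub>R a s) = 0" "s \<in> J" for J c s
    by (rule pencil_eigenvectors_independent[OF B(1,2) M ker1 ker2, of J a b c s])
      (use that a1 b1 a2 ne in blast)+
  have inj: "inj_on a I"
  proof (rule inj_onI, rule ccontr)
    fix s s' assume s: "s \<in> I" "s' \<in> I" "a s = a s'" "s \<noteq> s'"
    then have "(\<Sum>r\<in>{s, s'}. (if r = s then 1 else -1) *\<^sub>R a r) = 0" by simp
    then have "(if s = s then 1 else -1 :: real) = 0" by (rule indep[rotated 2]) (use s in auto)
    then show False by simp
  qed
  have "independent (a ` I)"
  proof
    assume "dependent (a ` I)"
    then obtain T u v where T: "finite T" "T \<subseteq> a ` I" "v \<in> T" "u v \<noteq> 0" "(\<Sum>v\<in>T. u v *\<^sub>R v) = 0"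
      unfolding dependent_explicit by blast
    define J where "J = {s \<in> I. a s \<in> T}"
    have J: "J \<subseteq> I" "a ` J = T" using T(2) by (auto simp: J_def)
    have injJ: "inj_on a J" using inj J(1) by (rule inj_on_subset)
    have "finite J" using J(2) T(1) injJ finite_imageD by blast
    moreover have "(\<Sum>s\<in>J. u (a s) *\<^sub>R a s) = 0"
      using T(5) sum.reindex[OF injJ, of "\<lambda>v. u v *\<^sub>R v"] J(2) by (simp add: o_def)
    ultimately have "u (a s) = 0" if "s \<in> J" for s using indep[of J "\<lambda>s. u (a s)"] J(1) that by blast
    then show False using T(3,4) J(2) by blast
  qed
  moreover have "a ` I \<subseteq> span S" using p by blast
  ultimately have "finite (a ` I)" using independent_span_bound[OF S] by blast
  then show ?thesis using inj finite_imageD by blast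
qed

section \<open>Matrices as forms\<close>

text \<open>Vectors are plain functions of which only the first \<open>n\<close> values matter, so
  that blocks of a vector are obtained by shifting or scaling the index.\<close>

definition form :: "nat \<Rightarrow> complex mat \<Rightarrow> (nat \<Rightarrow> complex) \<Rightarrow> (nat \<Rightarrow> complex) \<Rightarrow> complex" where
  "form n A x y = (\<Sum>i<n. \<Sum>j<n. A $$ (i, j) * x j * cnj (y i))"

lemma qform_eq_form:
  assumes "A \<in> carrier_mat n n" "v \<in> carrier_vec n"
  shows "qform A v = form n A (vec_index v) (vec_index v)"
  using assms unfolding qform_def form_def
  by (auto simp: scalar_prod_def mult_mat_vec_def sum_distrib_right atLeast0LessThan intro!: sum.cong)

lemma Her_iff:
  "A \<in> Her n \<longleftrightarrow> A \<in> carrier_mat n n \<and> (\<forall>i<n. \<forall>j<n. cnj (A $$ (j, i)) = A $$ (i, j))"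
proof (cases "A \<in> carrier_mat n n")
  case True
  then have "mat_adjoint A $$ (i, j) = cnj (A $$ (j, i))" if "i < n" "j < n" for i j
    using that by (simp add: mat_adjoint_def mat_of_rows_index)
  moreover have "mat_adjoint A \<in> carrier_mat n n" using True by (auto simp: mat_adjoint_def)
  ultimately have "mat_adjoint A = A \<longleftrightarrow> (\<forall>i<n. \<forall>j<n. cnj (A $$ (j, i)) = A $$ (i, j))"
    using True by (simp add: mat_eq_iff)
  then show ?thesis using True by (simp add: Her_def)
qed (simp add: Her_def)

lemma form_commute:
  assumes "A \<in> Her n"
  shows "form n A y x = cnj (form n A x y)"
proof -
  have "cnj (form n A x y) = (\<Sum>i<n. \<Sum>j<n. A $$ (j, i) * cnj (x j) * y i)"
    using assms unfolding form_def by (auto simp: Her_iff intro!: sum.cong)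
  also have "\<dots> = form n A y x" unfolding form_def
    by (subst sum.swap) (simp add: mult_ac)
  finally show ?thesis ..
qed

lemma form_linear:
  "form n A (x + y) z = form n A x z + form n A y z" "form n A (c *\<^sub>R x) z = c *\<^sub>R form n A x z"
  by (simp_all add: form_def plus_fun_def scaleR_fun_def algebra_simps sum.distrib scaleR_sum_right)

lemma form_cong:
  assumes "\<And>i. i < n \<Longrightarrow> x i = x' i" "\<And>i. i < n \<Longrightarrow> y i = y' i"
  shows "form n A x y = form n A x' y'"
  using assms by (simp add: form_def)

lemma psd_iff_form: "psd n A \<longleftrightarrow> A \<in> Her n \<and> (\<forall>x. 0 \<le> Re (form n A x x))"
proof (cases "A \<in> Her n")
  case True
  then have A: "A \<in> carrier_mat n n" by (simp add: Her_iff)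
  have "Im (form n A x x) = 0" for x using form_commute[OF True, of x x]
    by (metis Reals_cnj_iff complex_is_Real_iff)
  then have nn: "0 \<le> form n A x x \<longleftrightarrow> 0 \<le> Re (form n A x x)" for x
    by (simp add: less_eq_complex_def)
  have "form n A x x = qform A (Matrix.vec n x)" for x
    by (subst qform_eq_form[OF A]) (auto intro: form_cong)
  then have "(\<forall>v\<in>carrier_vec n. 0 \<le> qform A v) \<longleftrightarrow> (\<forall>x. 0 \<le> form n A x x)"
    using qform_eq_form[OF A] by (metis vec_carrier)
  then show ?thesis using True nn by (simp add: psd_def)
qed (simp add: psd_def)

lemma psd_bilinear_form:
  assumes "A \<in> Her n" "\<And>x. 0 \<le> Re (form n A x x)"
  shows "psd_bilinear (\<lambda>x y. Re (form n A x y))"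
proof (rule psd_bilinearI)
  show "Re (form n A x y) = Re (form n A y x)" for x y using form_commute[OF assms(1), of x y] by simp
qed (simp_all add: form_linear assms(2))

lemma sum_mat_carrier [simp]: "sum_mat n M I \<in> carrier_mat n n"
  by (simp add: sum_mat_def)

lemma sum_mat_index: "i < n \<Longrightarrow> j < n \<Longrightarrow> sum_mat n M I $$ (i, j) = (\<Sum>k\<in>I. M k $$ (i, j))"
  by (simp add: sum_mat_def)

lemma form_sum_mat: "form n (sum_mat n M I) x y = (\<Sum>k\<in>I. form n (M k) x y)"
proof -
  have "form n (sum_mat n M I) x y = (\<Sum>i<n. \<Sum>j<n. \<Sum>k\<in>I. M k $$ (i, j) * x j * cnj (y i))"
    by (simp add: form_def sum_mat_index sum_distrib_right)
  also have "\<dots> = (\<Sum>i<n. \<Sum>k\<in>I. \<Sum>j<n. M k $$ (i, j) * x j * cnj (y i))"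
    by (intro sum.cong refl sum.swap)
  also have "\<dots> = (\<Sum>k\<in>I. form n (M k) x y)" unfolding form_def by (rule sum.swap)
  finally show ?thesis .
qed

lemma form_smult: "A \<in> carrier_mat n n \<Longrightarrow> form n (c \<cdot>\<^sub>m A) x y = c * form n A x y"
  by (simp add: form_def sum_distrib_left mult.assoc)

lemma Her_sum_mat:
  assumes "\<And>k. k \<in> I \<Longrightarrow> M k \<in> Her n"
  shows "sum_mat n M I \<in> Her n"
  using assms by (auto simp: Her_iff sum_mat_index intro!: sum.cong)

lemma Her_smult: "A \<in> Her n \<Longrightarrow> complex_of_real c \<cdot>\<^sub>m A \<in> Her n"
  by (auto simp: Her_iff)

section \<open>Kronecker products in block form\<close>

lemma sum_lessThan_mult:
  fixes g :: "nat \<Rightarrow> 'a::comm_monoid_add"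
  shows "(\<Sum>i<r * s. g i) = (\<Sum>i<r. \<Sum>a<s. g (i * s + a))"
  by (subst sum.nat_group[symmetric])
    (simp add: sum.atLeastLessThan_shift_0 atLeast0LessThan)

lemma kronecker_carrier:
  "A \<in> carrier_mat r r \<Longrightarrow> B \<in> carrier_mat s s \<Longrightarrow> A \<otimes>\<^sub>K B \<in> carrier_mat (r * s) (r * s)"
  by (auto simp: kronecker_def)

lemma Her_kronecker:
  assumes "A \<in> Her r" "B \<in> Her s"
  shows "A \<otimes>\<^sub>K B \<in> Her (r * s)"
proof -
  have *: "i div s < r" "i mod s < s" if "i < r * s" for i
    using that by (auto simp: less_mult_imp_div_less intro!: mod_less_divisor gr0I)
  have "A \<in> carrier_mat r r" "B \<in> carrier_mat s s" using assms by (simp_all add: Her_iff)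
  moreover from this have "cnj ((A \<otimes>\<^sub>K B) $$ (j, i)) = (A \<otimes>\<^sub>K B) $$ (i, j)" if "i < r * s" "j < r * s" for i j
  proof -
    have "cnj (A $$ (j div s, i div s)) = A $$ (i div s, j div s)"
      "cnj (B $$ (j mod s, i mod s)) = B $$ (i mod s, j mod s)"
      using assms *[OF that(1)] *[OF that(2)] by (auto simp: Her_iff)
    then show ?thesis using that \<open>A \<in> carrier_mat r r\<close> \<open>B \<in> carrier_mat s s\<close> by (simp add: kronecker_def)
  qed
  ultimately show ?thesis using kronecker_carrier by (simp add: Her_iff)
qed

lemma mult_add_less_mult:
  assumes "i < r" "a < (s::nat)"
  shows "i * s + a < r * s"
proof -
  have "i * s + a < Suc i * s" using assms(2) by simp
  also have "\<dots> \<le> r * s" using assms(1) by (intro mult_le_mono1) simp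
  finally show ?thesis .
qed

lemma form_kronecker:
  assumes A: "A \<in> carrier_mat r r" and B: "B \<in> carrier_mat s s"
  shows "form (r * s) (A \<otimes>\<^sub>K B) x y =
    (\<Sum>i<r. \<Sum>j<r. A $$ (i, j) * form s B (\<lambda>b. x (j * s + b)) (\<lambda>b. y (i * s + b)))"
proof -
  have ent: "(A \<otimes>\<^sub>K B) $$ (i * s + a, j * s + b) = A $$ (i, j) * B $$ (a, b)"
    if "i < r" "j < r" "a < s" "b < s" for i j a b
  proof -
    have "i * s + a < r * s" "j * s + b < r * s"
      using that by (simp_all add: mult_add_less_mult)
    then show ?thesis using that A B by (simp add: kronecker_def)
  qed
  have "form (r * s) (A \<otimes>\<^sub>K B) x y = (\<Sum>i<r. \<Sum>a<s. \<Sum>j<r. \<Sum>b<s.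
      A $$ (i, j) * (B $$ (a, b) * x (j * s + b) * cnj (y (i * s + a))))"
    unfolding form_def sum_lessThan_mult by (intro sum.cong) (auto simp: ent mult.assoc)
  also have "\<dots> = (\<Sum>i<r. \<Sum>j<r. \<Sum>a<s. \<Sum>b<s.
      A $$ (i, j) * (B $$ (a, b) * x (j * s + b) * cnj (y (i * s + a))))"
    by (intro sum.cong refl sum.swap)
  finally show ?thesis by (simp add: form_def sum_distrib_left)
qed

text \<open>Here the sum is grouped by the entries of \<open>B\<close>. For small \<open>B\<close>
  this presents the form of a realization as an array of forms of the matrices
  \<open>T k\<close>.\<close>

lemma form_kronecker':
  assumes A: "A \<in> carrier_mat r r" and B: "B \<in> carrier_mat s s"
  shows "form (r * s) (A \<otimes>\<^sub>K B) x y =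
    (\<Sum>a<s. \<Sum>b<s. B $$ (a, b) * form r A (\<lambda>i. x (i * s + b)) (\<lambda>i. y (i * s + a)))"
proof -
  let ?t = "\<lambda>i j a b. A $$ (i, j) * (B $$ (a, b) * x (j * s + b) * cnj (y (i * s + a)))"
  have "form (r * s) (A \<otimes>\<^sub>K B) x y = (\<Sum>i<r. \<Sum>j<r. \<Sum>a<s. \<Sum>b<s. ?t i j a b)"
    unfolding form_kronecker[OF A B] by (simp add: form_def sum_distrib_left)
  also have "\<dots> = (\<Sum>i<r. \<Sum>a<s. \<Sum>j<r. \<Sum>b<s. ?t i j a b)" by (intro sum.cong refl sum.swap)
  also have "\<dots> = (\<Sum>a<s. \<Sum>i<r. \<Sum>j<r. \<Sum>b<s. ?t i j a b)" by (rule sum.swap)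
  also have "\<dots> = (\<Sum>a<s. \<Sum>i<r. \<Sum>b<s. \<Sum>j<r. ?t i j a b)" by (intro sum.cong refl sum.swap)
  also have "\<dots> = (\<Sum>a<s. \<Sum>b<s. \<Sum>i<r. \<Sum>j<r. ?t i j a b)" by (intro sum.cong refl sum.swap)
  finally show ?thesis by (simp add: form_def sum_distrib_left mult_ac)
qed

section \<open>Simplex cones and the largest system\<close>

lemma C_min_subset_C_max:
  assumes C: "convex_cone C"
  shows "C_min C s \<subseteq> C_max C s"
proof
  fix A assume "A \<in> C_min C s"
  then obtain m :: nat and c P where cP': "\<forall>i<m. c i \<in> C \<and> psd s (P i)"
    and A: "A = (\<lambda>k. sum_mat s (\<lambda>i. tensor_tuple (c i) (P i) k) {..<m})"
    unfolding C_min_def by auto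
  have cP: "c i \<in> C" "psd s (P i)" if "i < m" for i using cP' that by blast+
  have PH: "P i \<in> Her s" if "i < m" for i using cP(2)[OF that] by (simp add: psd_def)
  then have Pc: "P i \<in> carrier_mat s s" if "i < m" for i using that by (simp add: Her_iff)
  have AH: "A k \<in> Her s" for k
    unfolding A tensor_tuple_def using PH by (intro Her_sum_mat Her_smult) auto
  have "(\<chi> k. Re (qform (A k) v)) \<in> C" if v: "v \<in> carrier_vec s" for v
  proof -
    let ?q = "\<lambda>i. Re (form s (P i) (vec_index v) (vec_index v))"
    have "(\<chi> k. Re (qform (A k) v)) = (\<chi> k. \<Sum>i<m. vec_nth (c i) k * ?q i)"
      using Pc by (simp add: A qform_eq_form[OF sum_mat_carrier v] form_sum_mat tensor_tuple_def form_smult)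
    also have "\<dots> = (\<Sum>i<m. ?q i *\<^sub>R c i)" by (simp add: Finite_Cartesian_Product.vec_eq_iff mult.commute)
    also have "\<dots> \<in> C"
    proof -
      have "(\<Sum>i\<in>I. ?q i *\<^sub>R c i) \<in> C" if "I \<subseteq> {..<m}" for I
        using finite_subset[OF that finite_lessThan] that
      proof (induction I rule: finite_induct)
        case empty then show ?case using convex_cone_contains_0[OF C] by simp
      next
        case (insert i I)
        then have "?q i *\<^sub>R c i \<in> C" using cP[of i] by (intro convex_cone_scaleR[OF C]) (auto simp: psd_iff_form)
        then show ?case using insert convex_cone_add[OF C] by simp
      qed
      then show ?thesis by blast
    qed
    finally show ?thesis .
  qed
  then show "A \<in> C_max C s" using AH by (simp add: C_max_def)
qed

text \<open>The coordinate functionals \<open>p b\<close> of the basis are nonnegative on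
  \<open>C\<close>. The quadratic form of \<open>P b\<close> at a vector is the
  \<open>b\<close>-coordinate of the point of \<open>C\<close> that the tuple has there, whence
  \<open>P b\<close> is positive.\<close>

lemma simplex_C_max_subset_C_min:
  fixes C :: "(real ^ 'd) set"
  assumes "simplex_cone C"
  shows "C_max C s \<subseteq> C_min C s"
proof
  fix A assume A: "A \<in> C_max C s"
  obtain B where B: "independent B" "card B = DIM(real ^ 'd)" and C: "C = convex_cone hull B"
    using assms unfolding simplex_cone_def by blast
  have fin: "finite B" using B(1) by (rule independent_imp_finite)
  have "dim B = DIM(real ^ 'd)" using B dim_eq_card_independent by metis
  then have sp: "span B = UNIV" by (rule iffD1[OF dim_eq_full])
  define R where "R = representation B"
  have Rsum: "(\<Sum>b\<in>B. R x b *\<^sub>R b) = x" for x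
    unfolding R_def by (rule sum_representation_eq[OF B(1)]) (use sp fin in auto)
  have Radd: "R (x + y) b = R x b + R y b" for x y b
    unfolding R_def using sp by (simp add: representation_add[OF B(1)])
  have Rscale: "R (c *\<^sub>R x) b = c * R x b" for c x b
    unfolding R_def using sp by (simp add: representation_scale[OF B(1)])
  have R0: "R 0 b = 0" for b using Rscale[of 0 0 b] by simp
  have Rnn: "0 \<le> R x b" if "x \<in> C" for x b
  proof -
    have "C \<subseteq> {x. \<forall>b. 0 \<le> R x b}" unfolding C
    proof (rule hull_minimal)
      show "B \<subseteq> {x. \<forall>b. 0 \<le> R x b}" by (auto simp: R_def representation_basis[OF B(1)])
      show "convex_cone {x. \<forall>b. 0 \<le> R x b}"
        unfolding convex_cone_iff by (simp add: R0 Radd Rscale)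
    qed
    then show ?thesis using that by blast
  qed
  define p where "p b k = R (axis k 1) b" for b k
  have Rp: "R x b = (\<Sum>k\<in>UNIV. vec_nth x k * p b k)" for x b
  proof -
    have "R (\<Sum>k\<in>K. vec_nth x k *\<^sub>R axis k 1) b = (\<Sum>k\<in>K. vec_nth x k * p b k)" for K
      by (induction K rule: infinite_finite_induct) (simp_all add: R0 Radd Rscale p_def)
    from this[of UNIV] show ?thesis by (simp add: basis_expansion scalar_mult_eq_scaleR[symmetric])
  qed
  have AH: "A k \<in> Her s" for k using A by (simp add: C_max_def)
  then have Ac: "A k \<in> carrier_mat s s" for k by (simp add: Her_iff)
  define P where "P b = sum_mat s (\<lambda>k. complex_of_real (p b k) \<cdot>\<^sub>m A k) UNIV" for b
  have P: "psd s (P b)" for b unfolding psd_iff_form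
  proof
    show "P b \<in> Her s" unfolding P_def by (intro Her_sum_mat Her_smult AH)
    show "\<forall>x. 0 \<le> Re (form s (P b) x x)"
    proof
      fix x
      have "form s (A k) x x = qform (A k) (Matrix.vec s x)" for k
        by (subst qform_eq_form[OF Ac]) (auto intro: form_cong)
      then have "Re (form s (P b) x x) = (\<Sum>k\<in>UNIV. p b k * Re (qform (A k) (Matrix.vec s x)))"
        by (simp add: P_def form_sum_mat form_smult Ac)
      also have "\<dots> = R (\<chi> k. Re (qform (A k) (Matrix.vec s x))) b" by (simp add: Rp mult.commute)
      also have "\<dots> \<ge> 0" using A by (intro Rnn) (simp add: C_max_def)
      finally show "0 \<le> Re (form s (P b) x x)" .
    qed
  qed
  obtain h where h: "bij_betw h {0..<card B} B" using ex_bij_betw_nat_finite[OF fin] by blast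
  \<comment> \<open>The expansion of \<open>axis l 1\<close> in the basis, read off in coordinate
    \<open>k\<close>.\<close>
  have delta: "(\<Sum>b\<in>B. vec_nth b k * p b l) = (if k = l then 1 else 0)" for k l
  proof -
    have "(\<Sum>b\<in>B. vec_nth b k * p b l) = vec_nth (\<Sum>b\<in>B. R (axis l 1) b *\<^sub>R b) k"
      by (simp add: p_def mult.commute)
    then show ?thesis unfolding Rsum by (simp add: axis_def)
  qed
  have "A k = sum_mat s (\<lambda>i. tensor_tuple (h i) (P (h i)) k) {..<card B}" for k
  proof (rule eq_matI)
    fix i j assume "i < dim_row (sum_mat s (\<lambda>i. tensor_tuple (h i) (P (h i)) k) {..<card B})"
      "j < dim_col (sum_mat s (\<lambda>i. tensor_tuple (h i) (P (h i)) k) {..<card B})"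
    then have ij: "i < s" "j < s" by (simp_all add: sum_mat_def)
    have "sum_mat s (\<lambda>i. tensor_tuple (h i) (P (h i)) k) {..<card B} $$ (i, j) =
      (\<Sum>n<card B. complex_of_real (vec_nth (h n) k) * P (h n) $$ (i, j))"
      using ij by (simp add: sum_mat_index tensor_tuple_def P_def sum_mat_def)
    also have "\<dots> = (\<Sum>b\<in>B. complex_of_real (vec_nth b k) * P b $$ (i, j))"
      using sum.reindex_bij_betw[OF h, of "\<lambda>b. complex_of_real (vec_nth b k) * P b $$ (i, j)"]
      by (simp add: atLeast0LessThan)
    also have "\<dots> = (\<Sum>b\<in>B. \<Sum>l\<in>UNIV. complex_of_real (vec_nth b k * p b l) * A l $$ (i, j))"
      using ij by (simp add: P_def sum_mat_index carrier_matD[OF Ac] sum_distrib_left mult.assoc)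
    also have "\<dots> = (\<Sum>l\<in>UNIV. complex_of_real (\<Sum>b\<in>B. vec_nth b k * p b l) * A l $$ (i, j))"
      by (subst sum.swap) (simp add: sum_distrib_right)
    also have "\<dots> = (\<Sum>l\<in>UNIV. if k = l then A l $$ (i, j) else 0)" by (intro sum.cong) (auto simp: delta)
    also have "\<dots> = A k $$ (i, j)" by simp
    finally show "A k $$ (i, j) = sum_mat s (\<lambda>i. tensor_tuple (h i) (P (h i)) k) {..<card B} $$ (i, j)" ..
  qed (use Ac in \<open>auto simp: sum_mat_def\<close>)
  moreover have "h i \<in> C" if "i < card B" for i
    unfolding C using bij_betw_apply[OF h, of i] that by (intro hull_inc) simp
  ultimately show "A \<in> C_min C s" unfolding C_min_def
    by (intro CollectI exI[of _ "card B"] exI[of _ h] exI[of _ "\<lambda>i. P (h i)"]) (simp add: P fun_eq_iff)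
qed

text \<open>The realization is diagonal, with one entry for each half-space \<open>0 \<le> a i \<bullet> x\<close>.\<close>

lemma C_max_realizable:
  fixes C :: "(real ^ 'd) set" and r :: nat
  assumes C: "C = {x. \<forall>i<r. 0 \<le> a i \<bullet> x}" and r: "r \<ge> 1" and u: "\<And>i. i < r \<Longrightarrow> 0 < a i \<bullet> u"
  shows "fd_realizable (C_max C) u"
proof -
  \<comment> \<open>Dividing by the positive number \<open>a i \<bullet> u\<close> turns the image
    of the order unit into the identity.\<close>
  define t where "t i k = vec_nth (a i) k / (a i \<bullet> u)" for i k
  define T where "T k = Matrix.mat r r (\<lambda>(i, j). if i = j then complex_of_real (t i k) else 0)" for k
  have Tc: "T k \<in> carrier_mat r r" for k by (simp add: T_def)
  have TH: "T k \<in> Her r" for k by (simp add: Her_iff T_def)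
  have unit: "sum_mat r (\<lambda>k. complex_of_real (vec_nth u k) \<cdot>\<^sub>m T k) UNIV = 1\<^sub>m r"
  proof (rule eq_matI)
    fix i j assume "i < dim_row (1\<^sub>m r :: complex mat)" "j < dim_col (1\<^sub>m r :: complex mat)"
    then have ij: "i < r" "j < r" by simp_all
    have "(\<Sum>k\<in>UNIV. vec_nth u k * t i k) = (\<Sum>k\<in>UNIV. vec_nth (a i) k * vec_nth u k) / (a i \<bullet> u)"
      by (simp add: t_def sum_divide_distrib mult.commute)
    also have "\<dots> = 1" using u[OF ij(1)] by (simp add: inner_vec_def)
    finally have *: "(\<Sum>k\<in>UNIV. complex_of_real (vec_nth u k) * complex_of_real (t i k)) = 1"
      by (metis (no_types, lifting) of_real_1 of_real_mult of_real_sum sum.cong)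
    show "sum_mat r (\<lambda>k. complex_of_real (vec_nth u k) \<cdot>\<^sub>m T k) UNIV $$ (i, j) = 1\<^sub>m r $$ (i, j)"
    proof (cases "i = j")
      case True
      then show ?thesis using ij * by (simp add: sum_mat_index T_def)
    next
      case False
      then show ?thesis using ij by (simp add: sum_mat_index T_def)
    qed
  qed (simp_all add: sum_mat_def)
  have "A \<in> C_max C s \<longleftrightarrow> psd (r * s) (sum_mat (r * s) (\<lambda>k. T k \<otimes>\<^sub>K A k) UNIV)"
    if AH: "\<forall>k. A k \<in> Her s" for s A
  proof -
    have Ac: "A k \<in> carrier_mat s s" for k using AH by (simp add: Her_iff)
    define q where "q i x = (\<Sum>k\<in>UNIV. t i k * Re (form s (A k) x x))" for i x
    have "form (r * s) (T k \<otimes>\<^sub>K A k) w w =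
      (\<Sum>i<r. complex_of_real (t i k) * form s (A k) (\<lambda>b. w (i * s + b)) (\<lambda>b. w (i * s + b)))" for k w
    proof -
      have "form (r * s) (T k \<otimes>\<^sub>K A k) w w = (\<Sum>i<r. \<Sum>j<r. if i = j then
          complex_of_real (t i k) * form s (A k) (\<lambda>b. w (i * s + b)) (\<lambda>b. w (i * s + b)) else 0)"
        unfolding form_kronecker[OF Tc Ac] by (intro sum.cong) (auto simp: T_def)
      then show ?thesis by simp
    qed
    then have F: "Re (form (r * s) (sum_mat (r * s) (\<lambda>k. T k \<otimes>\<^sub>K A k) UNIV) w w) =
      (\<Sum>i<r. q i (\<lambda>b. w (i * s + b)))" for w
      unfolding form_sum_mat q_def by (simp add: sum.swap[of _ UNIV])
    have H: "sum_mat (r * s) (\<lambda>k. T k \<otimes>\<^sub>K A k) UNIV \<in> Her (r * s)"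
      using AH by (intro Her_sum_mat Her_kronecker TH) auto
    have qa: "q i x * (a i \<bullet> u) = a i \<bullet> (\<chi> k. Re (form s (A k) x x))" if "i < r" for i x
      using u[OF that] by (simp add: q_def t_def inner_vec_def sum_distrib_right)
    have qi: "0 \<le> a i \<bullet> (\<chi> k. Re (form s (A k) x x)) \<longleftrightarrow> 0 \<le> q i x" if "i < r" for i x
      unfolding qa[OF that, symmetric] using u[OF that] by (simp add: zero_le_mult_iff)
    have "A \<in> C_max C s \<longleftrightarrow> (\<forall>x. (\<chi> k. Re (form s (A k) x x)) \<in> C)"
    proof -
      have "qform (A k) (Matrix.vec s x) = form s (A k) x x" for k x
        by (subst qform_eq_form[OF Ac]) (auto intro: form_cong)
      then have fq: "form s (A k) x x = qform (A k) (Matrix.vec s x)" for k x by simp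
      have "(\<forall>v\<in>carrier_vec s. (\<chi> k. Re (qform (A k) v)) \<in> C) \<longleftrightarrow>
          (\<forall>x. (\<chi> k. Re (form s (A k) x x)) \<in> C)"
      proof (intro iffI ballI allI)
        fix x assume "\<forall>v\<in>carrier_vec s. (\<chi> k. Re (qform (A k) v)) \<in> C"
        then show "(\<chi> k. Re (form s (A k) x x)) \<in> C" unfolding fq by (rule bspec) simp
      next
        fix v :: "complex Matrix.vec"
        assume F: "\<forall>x. (\<chi> k. Re (form s (A k) x x)) \<in> C" and v: "v \<in> carrier_vec s"
        have "qform (A k) v = form s (A k) (vec_index v) (vec_index v)" for k
          by (rule qform_eq_form[OF Ac v])
        then show "(\<chi> k. Re (qform (A k) v)) \<in> C" using F by simp
      qed
      then show ?thesis using AH by (simp add: C_max_def)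
    qed
    also have "\<dots> \<longleftrightarrow> (\<forall>x. \<forall>i<r. 0 \<le> q i x)"
      unfolding C using qi by simp
    also have "\<dots> \<longleftrightarrow> (\<forall>w. 0 \<le> (\<Sum>i<r. q i (\<lambda>b. w (i * s + b))))"
    proof (intro iffI allI impI)
      fix w assume "\<forall>x. \<forall>i<r. 0 \<le> q i x"
      then show "0 \<le> (\<Sum>i<r. q i (\<lambda>b. w (i * s + b)))" by (intro sum_nonneg) auto
    next
      fix x :: "nat \<Rightarrow> complex" and i assume nn: "\<forall>w. 0 \<le> (\<Sum>i<r. q i (\<lambda>b. w (i * s + b)))" and i: "i < r"
      \<comment> \<open>A vector supported on block \<open>i\<close> isolates the summand
        \<open>q i\<close>.\<close>
      define w where "w n = (if n div s = i then x (n mod s) else 0)" for n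
      have wj: "form s (A k) (\<lambda>b. w (j * s + b)) (\<lambda>b. w (j * s + b)) =
        (if j = i then form s (A k) x x else 0)" for j k
      proof -
        have "form s (A k) (\<lambda>b. w (j * s + b)) (\<lambda>b. w (j * s + b)) =
          form s (A k) (if j = i then x else (\<lambda>_. 0)) (if j = i then x else (\<lambda>_. 0))"
          by (rule form_cong) (auto simp: w_def)
        then show ?thesis by (simp add: form_def)
      qed
      have "(\<Sum>j<r. q j (\<lambda>b. w (j * s + b))) = (\<Sum>j<r. if j = i then q i x else 0)"
        unfolding q_def wj by (intro sum.cong) auto
      also have "\<dots> = q i x" using i by simp
      finally have "(\<Sum>j<r. q j (\<lambda>b. w (j * s + b))) = q i x" .
      then show "0 \<le> q i x" using nn[rule_format, of w] by simp
    qed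
    also have "\<dots> \<longleftrightarrow> psd (r * s) (sum_mat (r * s) (\<lambda>k. T k \<otimes>\<^sub>K A k) UNIV)"
      unfolding psd_iff_form F using H by simp
    finally show ?thesis .
  qed
  then show ?thesis unfolding fd_realizable_def using r TH unit by blast
qed

lemma polyhedral_cone_C_max_realizable:
  fixes C :: "(real ^ 'd) set"
  assumes "polyhedral_cone C" and sal: "salient C" and u: "u \<in> interior C"
  shows "fd_realizable (C_max C) u"
proof -
  obtain F where F: "finite F" "C = \<Inter>F" and "\<forall>h\<in>F. \<exists>a. a \<noteq> 0 \<and> h = {x. 0 \<le> a \<bullet> x}"
    using assms(1) unfolding polyhedral_cone_def by blast
  from bchoice[OF this(3)] obtain a where a: "\<And>h. h \<in> F \<Longrightarrow> a h \<noteq> 0 \<and> h = {x. 0 \<le> a h \<bullet> x}" by blast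
  obtain e where e: "bij_betw e {0..<card F} F" using ex_bij_betw_nat_finite[OF F(1)] by blast
  have eF: "e i \<in> F" if "i < card F" for i using bij_betw_apply[OF e] that by simp
  have Fe: "F = e ` {0..<card F}" using e by (simp add: bij_betw_def)
  show ?thesis
  proof (rule C_max_realizable[of C "card F" "\<lambda>i. a (e i)"])
    show "C = {x. \<forall>i<card F. 0 \<le> a (e i) \<bullet> x}"
    proof -
      have "C = {x. \<forall>h\<in>F. 0 \<le> a h \<bullet> x}" using F(2) a by blast
      also have "\<dots> = {x. \<forall>i<card F. 0 \<le> a (e i) \<bullet> x}" by (subst Fe) auto
      finally show ?thesis .
    qed
    \<comment> \<open>With no half-spaces \<open>C\<close> would be the whole space, which is not
      salient because the index type is nonempty.\<close>
    show "1 \<le> card F"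
    proof (rule ccontr)
      assume "\<not> 1 \<le> card F"
      then have "F = {}" using F(1) by (simp add: not_le)
      then have "C = UNIV" using F(2) by simp
      then have "(UNIV :: (real ^ 'd) set) = {0}" using sal unfolding salient_def by auto
      then have "axis undefined 1 = (0 :: real ^ 'd)" by blast
      then show False by (simp add: axis_eq_0_iff)
    qed
    show "0 < a (e i) \<bullet> u" if i: "i < card F" for i
    proof -
      note ai = a[OF eF[OF i]]
      have "C \<subseteq> {x. 0 \<le> a (e i) \<bullet> x}" using F(2) eF[OF i] ai by blast
      then have "u \<in> interior {x. a (e i) \<bullet> x \<ge> 0}" using u interior_mono by blast
      moreover have "a (e i) \<noteq> 0" using ai by blast
      ultimately show ?thesis unfolding interior_halfspace_ge[OF \<open>a (e i) \<noteq> 0\<close>] by simp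
    qed
  qed
qed

section \<open>The smallest system of a cone that is not a simplex\<close>

text \<open>The difference of the two sides is \<open>f h + s g (f - g - h)\<close>. For
  \<open>h = 0\<close> it equals \<open>s g (f - g)\<close>, for \<open>f = 0\<close> it equals
  \<open>s (- g) (h + g)\<close>, so on the two edges every \<open>s\<close> in
  \<open>(0, 1)\<close> will do. Off the edges it tends to \<open>f h > 0\<close>.\<close>

lemma eventually_pencil_nonneg:
  fixes f g h :: real
  assumes "0 \<le> f" "0 \<le> h" and h0: "h = 0 \<Longrightarrow> 0 \<le> g \<and> g \<le> f" and f0: "f = 0 \<Longrightarrow> - h \<le> g \<and> g \<le> 0"
  shows "\<forall>\<^sub>F s in at_right 0. 0 \<le> f - s * g \<and> 0 \<le> h + s * g \<and> s * (1 - s) * g\<^sup>2 \<le> (f - s * g) * (h + s * g)"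
proof -
  have ev: "\<forall>\<^sub>F s in at_right (0::real). 0 < s \<and> s < 1"
    using eventually_at_right_real[of 0 "1::real"] by simp
  consider "h = 0" | "f = 0" | "0 < f" "0 < h" using assms(1,2) by linarith
  then show ?thesis
  proof cases
    case 1
    note g = h0[OF 1]
    show ?thesis using ev
    proof eventually_elim
      case (elim s)
      have "s * g \<le> 1 * g" using elim g by (intro mult_right_mono) auto
      moreover have "0 \<le> s * g * (f - g)" "0 \<le> s * g" using elim g by simp_all
      ultimately show ?case using 1 g by (simp add: power2_eq_square algebra_simps)
    qed
  next
    case 2
    note g = f0[OF 2]
    show ?thesis using ev
    proof eventually_elim
      case (elim s)
      have "s * (- g) \<le> 1 * (- g)" using elim g by (intro mult_right_mono) auto
      moreover have "0 \<le> s * (- g) * (h + g)" "0 \<le> s * (- g)" using elim g by (intro mult_nonneg_nonneg; simp)+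
      ultimately show ?case using 2 g by (simp add: power2_eq_square algebra_simps)
    qed
  next
    case 3
    have "((\<lambda>s. f - s * g) \<longlongrightarrow> f - 0 * g) (at_right 0)"
      and "((\<lambda>s. h + s * g) \<longlongrightarrow> h + 0 * g) (at_right 0)"
      and "((\<lambda>s. (f - s * g) * (h + s * g) - s * (1 - s) * g\<^sup>2) \<longlongrightarrow>
        (f - 0 * g) * (h + 0 * g) - 0 * (1 - 0) * g\<^sup>2) (at_right 0)"
      by (intro tendsto_intros)+
    from this[THEN order_tendstoD(1), of 0]
    have "\<forall>\<^sub>F s in at_right 0. 0 < f - s * g" "\<forall>\<^sub>F s in at_right 0. 0 < h + s * g"
      "\<forall>\<^sub>F s in at_right 0. 0 < (f - s * g) * (h + s * g) - s * (1 - s) * g\<^sup>2"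
      using 3 by simp_all
    then show ?thesis by eventually_elim simp
  qed
qed

text \<open>The trace pairing with the positive matrix with rows \<open>(a, b)\<close>,
  \<open>(b, c)\<close>. The value of \<open>P\<close> at the vector \<open>(a, b)\<close> is at
  most \<open>a\<close> times the pairing, because \<open>b\<^sup>2 \<le> a * c\<close>; for
  \<open>a = 0\<close> also \<open>b = 0\<close>.\<close>

lemma psd_pairing_nonneg:
  assumes P: "psd 2 P" and "0 \<le> a" "0 \<le> c" "b\<^sup>2 \<le> a * c"
  shows "0 \<le> a * Re (P $$ (0, 0)) + 2 * b * Re (P $$ (0, 1)) + c * Re (P $$ (1, 1))"
proof -
  have H: "P \<in> Her 2" and nn: "\<And>x. 0 \<le> Re (form 2 P x x)" using P by (simp_all add: psd_iff_form)
  have "cnj (P $$ (0, 1)) = P $$ (1, 0)" using H by (simp add: Her_iff)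
  then have P10: "Re (P $$ (1, 0)) = Re (P $$ (0, 1))" by (metis cnj.simps(1))
  have F: "0 \<le> x\<^sup>2 * Re (P $$ (0, 0)) + 2 * x * y * Re (P $$ (0, 1)) + y\<^sup>2 * Re (P $$ (1, 1))" for x y
    using nn[of "\<lambda>i. complex_of_real (if i = 0 then x else y)"] P10
    by (simp add: form_def numeral_2_eq_2 power2_eq_square algebra_simps)
  have P11: "0 \<le> Re (P $$ (1, 1))" using F[of 0 1] by simp
  show ?thesis
  proof (cases "a = 0")
    case True
    then show ?thesis using assms P11 by simp
  next
    case False
    have "0 \<le> a\<^sup>2 * Re (P $$ (0, 0)) + 2 * a * b * Re (P $$ (0, 1)) + b\<^sup>2 * Re (P $$ (1, 1))" by (rule F)
    also have "\<dots> \<le> a\<^sup>2 * Re (P $$ (0, 0)) + 2 * a * b * Re (P $$ (0, 1)) + a * c * Re (P $$ (1, 1))"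
      using assms(4) P11 by (simp add: mult_right_mono)
    also have "\<dots> = a * (a * Re (P $$ (0, 0)) + 2 * b * Re (P $$ (0, 1)) + c * Re (P $$ (1, 1)))"
      by (simp add: power2_eq_square algebra_simps)
    finally show ?thesis using False assms(2) by (simp add: zero_le_mult_iff)
  qed
qed

text \<open>The functionals \<open>f, g, h\<close> are the entries of a map from \<open>C\<close> to
  positive \<open>2 \<times> 2\<close> matrices. For a fixed \<open>P i\<close> the pairing is
  linear in the cone element, so it is enough to check generators.\<close>

lemma C_min_pairing_nonneg:
  fixes C :: "(real ^ 'd) set"
  assumes A: "A \<in> C_min C 2" and C: "C = convex_cone hull V"
    and V: "\<And>v. v \<in> V \<Longrightarrow> 0 \<le> f \<bullet> v \<and> 0 \<le> h \<bullet> v \<and> (g \<bullet> v)\<^sup>2 \<le> (f \<bullet> v) * (h \<bullet> v)"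
  shows "0 \<le> f \<bullet> (\<chi> k. Re (A k $$ (0, 0))) + 2 * (g \<bullet> (\<chi> k. Re (A k $$ (0, 1)))) + h \<bullet> (\<chi> k. Re (A k $$ (1, 1)))"
proof -
  obtain m :: nat and c P where cP: "\<forall>i<m. c i \<in> C \<and> psd 2 (P i)"
    and Ak: "A = (\<lambda>k. sum_mat 2 (\<lambda>i. tensor_tuple (c i) (P i) k) {..<m})"
    using A unfolding C_min_def by auto
  have Pc: "P i \<in> carrier_mat 2 2" if "i < m" for i
    using cP that by (simp add: psd_iff_form Her_iff)
  have ent: "w \<bullet> (\<chi> k. Re (A k $$ (a, b))) = (\<Sum>i<m. Re (P i $$ (a, b)) * (w \<bullet> c i))"
    if "a < 2" "b < 2" for w a b
  proof -
    have "(\<chi> k. Re (A k $$ (a, b))) = (\<Sum>i<m. Re (P i $$ (a, b)) *\<^sub>R c i)"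
      using that carrier_matD[OF Pc]
      by (simp add: Ak sum_mat_index tensor_tuple_def Finite_Cartesian_Product.vec_eq_iff mult.commute)
    then show ?thesis by (simp add: inner_sum_right)
  qed
  have "0 \<le> Re (P i $$ (0, 0)) * (f \<bullet> c i) + 2 * (Re (P i $$ (0, 1)) * (g \<bullet> c i)) + Re (P i $$ (1, 1)) * (h \<bullet> c i)"
    if i: "i < m" for i
  proof -
    define k where "k = Re (P i $$ (0, 0)) *\<^sub>R f + (2 * Re (P i $$ (0, 1))) *\<^sub>R g + Re (P i $$ (1, 1)) *\<^sub>R h"
    have "0 \<le> k \<bullet> v" if "v \<in> V" for v
      using psd_pairing_nonneg[of "P i" "f \<bullet> v" "h \<bullet> v" "g \<bullet> v"] cP i V[OF that]
      by (simp add: k_def inner_add_left algebra_simps)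
    then have "C \<subseteq> {x. 0 \<le> k \<bullet> x}" unfolding C by (intro hull_minimal convex_cone_halfspace_ge) auto
    then have "0 \<le> k \<bullet> c i" using cP i by blast
    then show ?thesis by (simp add: k_def inner_add_left mult.assoc)
  qed
  then have "0 \<le> (\<Sum>i<m. Re (P i $$ (0, 0)) * (f \<bullet> c i) + 2 * (Re (P i $$ (0, 1)) * (g \<bullet> c i)) + Re (P i $$ (1, 1)) * (h \<bullet> c i))"
    by (intro sum_nonneg) auto
  then show ?thesis by (simp add: ent sum.distrib sum_distrib_left)
qed

text \<open>The span is taken over the reals, hence two generators, with values \<open>1\<close> and
  \<open>\<i>\<close>, for each index.\<close>

lemma ex_span_finite_support:
  "\<exists>S :: (nat \<Rightarrow> complex) set. finite S \<and> (\<forall>x. (\<forall>i\<ge>n. x i = 0) \<longrightarrow> x \<in> span S)"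
proof -
  define e where "e z i = (\<lambda>j. if j = i then z else 0 :: complex)" for z and i :: nat
  let ?S = "e 1 ` {..<n} \<union> e \<i> ` {..<n}"
  have "x \<in> span ?S" if "\<forall>i\<ge>n. x i = 0" for x
  proof -
    have "x = (\<Sum>i<n. Re (x i) *\<^sub>R e 1 i + Im (x i) *\<^sub>R e \<i> i)"
    proof
      fix j
      have sum_app: "(\<Sum>i\<in>I. F i) j = (\<Sum>i\<in>I. F i j)" for I :: "nat set" and F :: "nat \<Rightarrow> nat \<Rightarrow> complex"
        by (induction I rule: infinite_finite_induct) (simp_all add: zero_fun_def plus_fun_def)
      have "(\<Sum>i<n. Re (x i) *\<^sub>R e 1 i + Im (x i) *\<^sub>R e \<i> i) j = (\<Sum>i<n. if i = j then x j else 0)"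
        unfolding sum_app by (intro sum.cong) (auto simp: e_def plus_fun_def scaleR_fun_def complex_eq_iff)
      also have "\<dots> = x j" using that by (simp add: not_less)
      finally show "x j = (\<Sum>i<n. Re (x i) *\<^sub>R e 1 i + Im (x i) *\<^sub>R e \<i> i) j" ..
    qed
    also have "\<dots> \<in> span ?S" by (intro span_sum span_add span_scale span_base) auto
    finally show ?thesis .
  qed
  then show ?thesis by (intro exI[of _ ?S]) auto
qed

text \<open>For small \<open>s > 0\<close> the tuple \<open>c3 \<otimes> e\<^sub>1 e\<^sub>1\<^sup>* + c1 \<otimes> e\<^sub>2 e\<^sub>2\<^sup>* + c2 \<otimes> p p\<^sup>* + c4 \<otimes> q q\<^sup>*\<close> with
  \<open>p = (1, s - 1)\<close> and \<open>q = (1, s)\<close> leaves \<open>C_min\<close> when \<open>\<epsilon> (c1 + c3) \<otimes> 1\<close> is subtracted, because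
  it is annihilated by the positive map with entries \<open>f - s g\<close>, \<open>g\<close>, \<open>(h + s g) / (s (1 - s))\<close>.
  A realization is therefore singular on it, and a kernel vector \<open>(a, b)\<close> produces the
  eigenvalue \<open>1 - s\<close> of a fixed operator of finite rank.\<close>

lemma C_min_realizable_imp_simplex:
  fixes C :: "(real ^ 'd) set"
  assumes cone: "convex_cone C" and poly: "polyhedral_cone C" and sal: "salient C"
    and u: "u \<in> interior C" and fd: "fd_realizable (C_min C) u"
  shows "simplex_cone C"
proof (rule ccontr)
  assume ns: "\<not> simplex_cone C"
  have int: "interior C \<noteq> {}" using u by blast
  obtain V f g h c1 c2 c3 c4 where finV: "finite V" and CV: "C = convex_cone hull V"
    and cC: "c1 \<in> C" "c2 \<in> C" "c3 \<in> C" "c4 \<in> C" and ceq: "c1 + c3 = c2 + c4"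
    and fc: "f \<bullet> c1 = 1" "f \<bullet> c2 = 1" "f \<bullet> c3 = 0" "f \<bullet> c4 = 0"
    and hc: "h \<bullet> c1 = 0" "h \<bullet> c2 = 0" "h \<bullet> c3 = 1" "h \<bullet> c4 = 1"
    and gc: "g \<bullet> c1 = 0" "g \<bullet> c2 = 1" "g \<bullet> c3 = 0" "g \<bullet> c4 = -1"
    and fV: "\<And>v. v \<in> V \<Longrightarrow> 0 \<le> f \<bullet> v" and hV: "\<And>v. v \<in> V \<Longrightarrow> 0 \<le> h \<bullet> v"
    and gh: "\<And>v. v \<in> V \<Longrightarrow> h \<bullet> v = 0 \<Longrightarrow> 0 \<le> g \<bullet> v \<and> g \<bullet> v \<le> f \<bullet> v"
    and gf: "\<And>v. v \<in> V \<Longrightarrow> f \<bullet> v = 0 \<Longrightarrow> - (h \<bullet> v) \<le> g \<bullet> v \<and> g \<bullet> v \<le> 0"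
    by (rule not_simplex_configuration[OF cone poly sal int ns]) blast
  have "\<forall>\<^sub>F s in at_right 0. \<forall>v\<in>V. 0 \<le> f \<bullet> v - s * (g \<bullet> v) \<and> 0 \<le> h \<bullet> v + s * (g \<bullet> v) \<and>
      s * (1 - s) * (g \<bullet> v)\<^sup>2 \<le> (f \<bullet> v - s * (g \<bullet> v)) * (h \<bullet> v + s * (g \<bullet> v))"
    by (rule eventually_ball_finite[OF finV ballI], rule eventually_pencil_nonneg) (use fV hV gh gf in auto)
  then obtain s1 where s1: "0 < s1" "\<And>s v. 0 < s \<Longrightarrow> s < s1 \<Longrightarrow> v \<in> V \<Longrightarrow>
      0 \<le> f \<bullet> v - s * (g \<bullet> v) \<and> 0 \<le> h \<bullet> v + s * (g \<bullet> v) \<and>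
      s * (1 - s) * (g \<bullet> v)\<^sup>2 \<le> (f \<bullet> v - s * (g \<bullet> v)) * (h \<bullet> v + s * (g \<bullet> v))"
    unfolding eventually_at_right_field by blast
  define I where "I = {0<..<min s1 1}"
  have infI: "infinite I" unfolding I_def using s1(1) by (simp add: infinite_Ioo)
  obtain r and T :: "'d \<Rightarrow> complex mat" where TH: "\<And>k. T k \<in> Her r"
    and real: "\<And>s A. s \<ge> 1 \<Longrightarrow> (\<forall>k. A k \<in> Her s) \<Longrightarrow>
      A \<in> C_min C s \<longleftrightarrow> psd (r * s) (sum_mat (r * s) (\<lambda>k. T k \<otimes>\<^sub>K A k) UNIV)"
    using fd unfolding fd_realizable_def by blast
  have Tc: "T k \<in> carrier_mat r r" for k using TH by (simp add: Her_iff)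
  define B where "B c x y = (\<Sum>k\<in>UNIV. vec_nth c k * Re (form r (T k) x y))" for c :: "real ^ 'd" and x y
  have Badd: "B (c + c') x y = B c x y + B c' x y" and Bscale: "B (t *\<^sub>R c) x y = t * B c x y"
    and Bdiff: "B (c - c') x y = B c x y - B c' x y" for c c' t x y
    by (simp_all add: B_def algebra_simps sum.distrib sum_subtractf sum_distrib_left)
  \<comment> \<open>Level 1 of the realization, tested on the element \<open>c\<close> of
    \<open>C_min\<close> itself.\<close>
  have Bpsd: "psd_bilinear (B c)" if c: "c \<in> C" for c
  proof -
    define A where "A k = sum_mat 1 (\<lambda>i. tensor_tuple c (1\<^sub>m 1) k) {..<1::nat}" for k
    define M where "M = sum_mat r (\<lambda>k. complex_of_real (vec_nth c k) \<cdot>\<^sub>m T k) UNIV"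
    have MH: "M \<in> Her r" unfolding M_def by (intro Her_sum_mat Her_smult TH)
    have one: "psd 1 (1\<^sub>m 1)" unfolding psd_iff_form Her_iff form_def by simp
    have AH: "\<forall>k. A k \<in> Her 1" unfolding A_def tensor_tuple_def
      using one by (intro allI Her_sum_mat Her_smult) (simp add: psd_def)
    have "A \<in> C_min C 1" unfolding C_min_def
      by (intro CollectI exI[of _ "1::nat"] exI[of _ "\<lambda>_. c"] exI[of _ "\<lambda>_. 1\<^sub>m 1"])
        (use one in \<open>simp add: c A_def fun_eq_iff\<close>)
    then have P: "psd (r * 1) (sum_mat (r * 1) (\<lambda>k. T k \<otimes>\<^sub>K A k) UNIV)" using real[OF _ AH] by simp
    have Ac: "A k \<in> carrier_mat 1 1" for k using AH by (simp add: Her_iff)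
    have A00: "A k $$ (0, 0) = complex_of_real (vec_nth c k)" for k
      by (simp add: A_def sum_mat_index tensor_tuple_def)
    have fM: "Re (form r M x y) = B c x y" for x y
      by (simp add: M_def form_sum_mat form_smult Tc B_def)
    have "form (r * 1) (T k \<otimes>\<^sub>K A k) x x = complex_of_real (vec_nth c k) * form r (T k) x x" for k x
      unfolding form_kronecker'[OF Tc Ac] using A00 by simp
    then have "Re (form (r * 1) (sum_mat (r * 1) (\<lambda>k. T k \<otimes>\<^sub>K A k) UNIV) x x) = B c x x" for x
      unfolding form_sum_mat by (simp add: B_def)
    then have "0 \<le> B c x x" for x using P unfolding psd_iff_form by metis
    then have "psd_bilinear (\<lambda>x y. Re (form r M x y))" using fM by (intro psd_bilinear_form[OF MH]) simp
    then show ?thesis unfolding fM .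
  qed
  note B1 = Bpsd[OF cC(1)] and B2 = Bpsd[OF cC(2)] and B3 = Bpsd[OF cC(3)] and B4 = Bpsd[OF cC(4)]
  \<comment> \<open>The second Kronecker factor has size 2, so even and odd indices carry the two
    components of \<open>w\<close>.\<close>
  define w0 where "w0 w = (\<lambda>i. w (i * 2))" for w :: "nat \<Rightarrow> complex"
  define w1 where "w1 w = (\<lambda>i. w (i * 2 + 1))" for w :: "nat \<Rightarrow> complex"
  have lin: "linear w0" "linear w1"
    by (auto intro!: linearI simp: w0_def w1_def plus_fun_def scaleR_fun_def)
  have lin': "linear (\<lambda>w. w0 w + t *\<^sub>R w1 w)" for t
    by (intro linear_compose_add linear_compose_scale_right lin)
  define m where "m = c1 + c3"
  \<comment> \<open>The kernel vectors of the rank-one matrices assigned to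
    \<open>c3, c1, c2, c4\<close> are \<open>(1, 0)\<close>, \<open>(0, 1)\<close>,
    \<open>(1, s - 1)\<close>, \<open>(1, s)\<close>. \<open>Q s\<close> is the form of the
    realization on the resulting tuple, and \<open>N\<close> is its form on
    \<open>m \<otimes> 1\<close>.\<close>
  define Q where "Q s x y = B c3 (w0 x) (w0 y) + B c1 (w1 x) (w1 y) +
    B c2 (w0 x + (s - 1) *\<^sub>R w1 x) (w0 y + (s - 1) *\<^sub>R w1 y) + B c4 (w0 x + s *\<^sub>R w1 x) (w0 y + s *\<^sub>R w1 y)" for s x y
  define N where "N x y = B m (w0 x) (w0 y) + B m (w1 x) (w1 y)" for x y
  have Qpsd: "psd_bilinear (Q s)" for s
    unfolding Q_def[abs_def]
    by (rule psd_bilinear_add[OF psd_bilinear_add[OF psd_bilinear_add[OF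
          psd_bilinear_compose[OF B3 lin(1)] psd_bilinear_compose[OF B1 lin(2)]]
          psd_bilinear_compose[OF B2 lin']] psd_bilinear_compose[OF B4 lin']])
  have mC: "m \<in> C" unfolding m_def by (rule convex_cone_add[OF cone cC(1,3)])
  have Npsd: "psd_bilinear N"
    unfolding N_def[abs_def]
    by (rule psd_bilinear_add[OF psd_bilinear_compose[OF Bpsd[OF mC] lin(1)] psd_bilinear_compose[OF Bpsd[OF mC] lin(2)]])
  obtain S :: "(nat \<Rightarrow> complex) set" where S: "finite S" "\<And>x. \<forall>i\<ge>r * 2. x i = 0 \<Longrightarrow> x \<in> span S"
    using ex_span_finite_support[of "r * 2"] by blast
  \<comment> \<open>Requiring \<open>N w w \<noteq> 0\<close> excludes vectors that are null for
    trivial reasons. If there were no such \<open>w\<close>, then \<open>N\<close> would be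
    dominated by \<open>Q s\<close>, and a small multiple of \<open>m \<otimes> 1\<close> could be
    subtracted inside \<open>C_min\<close>.\<close>
  have singular: "\<exists>w\<in>span S. Q s w w = 0 \<and> N w w \<noteq> 0" if s: "s \<in> I" for s
  proof (rule ccontr)
    assume "\<not> ?thesis"
    then obtain K where K: "K \<ge> 0" "\<forall>x\<in>span S. N x x \<le> K * Q s x x"
      using psd_bilinear_dominated[OF S(1) Qpsd[of s] Npsd] by blast
    define e where "e = 1 / (K + 1)"
    have e: "0 < e" using K(1) by (simp add: e_def)
    have s01: "0 < s" "s < s1" "s < 1" using s by (simp_all add: I_def)
    define p00 where "p00 = c3 + c2 + c4 - e *\<^sub>R m"
    define p01 where "p01 = (s - 1) *\<^sub>R c2 + s *\<^sub>R c4"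
    define p11 where "p11 = c1 + (s - 1)\<^sup>2 *\<^sub>R c2 + s\<^sup>2 *\<^sub>R c4 - e *\<^sub>R m"
    define A where "A k = Matrix.mat 2 2 (\<lambda>(a, b). complex_of_real
      (vec_nth (if a = b then (if a = 0 then p00 else p11) else p01) k))" for k
    have AH: "\<forall>k. A k \<in> Her 2" by (auto simp: A_def Her_iff)
    have Ac: "A k \<in> carrier_mat 2 2" for k by (simp add: A_def)
    have F: "Re (form (r * 2) (sum_mat (r * 2) (\<lambda>k. T k \<otimes>\<^sub>K A k) UNIV) w w) = Q s w w - e * N w w" for w
    proof -
      have "Re (form (r * 2) (T k \<otimes>\<^sub>K A k) w w) = vec_nth p00 k * Re (form r (T k) (w0 w) (w0 w)) +
        vec_nth p01 k * Re (form r (T k) (w1 w) (w0 w)) + vec_nth p01 k * Re (form r (T k) (w0 w) (w1 w)) +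
        vec_nth p11 k * Re (form r (T k) (w1 w) (w1 w))" for k
        unfolding form_kronecker'[OF Tc Ac] by (simp add: A_def numeral_2_eq_2 w0_def w1_def)
      then have "Re (form (r * 2) (sum_mat (r * 2) (\<lambda>k. T k \<otimes>\<^sub>K A k) UNIV) w w) =
        B p00 (w0 w) (w0 w) + B p01 (w1 w) (w0 w) + B p01 (w0 w) (w1 w) + B p11 (w1 w) (w1 w)"
        by (simp add: form_sum_mat B_def sum.distrib)
      also have "\<dots> = Q s w w - e * N w w"
        unfolding p00_def p01_def p11_def Q_def N_def
        by (simp add: Badd Bscale Bdiff psd_bilinearD[OF B2] psd_bilinearD[OF B4] power2_eq_square algebra_simps)
      finally show ?thesis .
    qed
    have nn: "0 \<le> Q s w w - e * N w w" for w
    proof -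
      \<comment> \<open>Domination is known only on \<open>span S\<close>; both forms ignore the
        entries from \<open>r * 2\<close> on, so \<open>w\<close> may be truncated.\<close>
      define x where "x i = (if i < r * 2 then w i else 0)" for i
      have xS: "x \<in> span S" by (intro S(2)) (simp add: x_def)
      have "form (r * 2) M x x = form (r * 2) M w w" for M by (rule form_cong) (simp_all add: x_def)
      then have "Q s w w - e * N w w = Q s x x - e * N x x" by (simp flip: F)
      have Ke: "e * (1 + K) = 1" using K(1) by (simp add: e_def)
      have "0 \<le> Q s x x" by (rule psd_bilinearD(5)[OF Qpsd])
      then have "K * Q s x x \<le> (1 + K) * Q s x x" by (simp add: distrib_right)
      then have "N x x \<le> (1 + K) * Q s x x" using K(2) xS by fastforce
      then have "e * N x x \<le> e * ((1 + K) * Q s x x)" using e by (intro mult_left_mono) auto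
      also have "\<dots> = (e * (1 + K)) * Q s x x" by (simp only: mult.assoc)
      finally have "e * N x x \<le> Q s x x" unfolding Ke by simp
      then show ?thesis using \<open>Q s w w - e * N w w = Q s x x - e * N x x\<close> by simp
    qed
    have "sum_mat (r * 2) (\<lambda>k. T k \<otimes>\<^sub>K A k) UNIV \<in> Her (r * 2)"
      using AH by (intro Her_sum_mat Her_kronecker TH) auto
    then have "psd (r * 2) (sum_mat (r * 2) (\<lambda>k. T k \<otimes>\<^sub>K A k) UNIV)"
      unfolding psd_iff_form F using nn by simp
    then have Amin: "A \<in> C_min C 2" using real[OF _ AH] by simp
    define f' where "f' = f - s *\<^sub>R g"
    define h' where "h' = (1 / (s * (1 - s))) *\<^sub>R (h + s *\<^sub>R g)"
    have ss: "0 < s * (1 - s)" using s01 by simp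
    have pos: "0 \<le> f' \<bullet> v \<and> 0 \<le> h' \<bullet> v \<and> (g \<bullet> v)\<^sup>2 \<le> (f' \<bullet> v) * (h' \<bullet> v)" if "v \<in> V" for v
    proof -
      note * = s1(2)[OF s01(1,2) that]
      have "(g \<bullet> v)\<^sup>2 \<le> (f \<bullet> v - s * (g \<bullet> v)) * (h \<bullet> v + s * (g \<bullet> v)) / (s * (1 - s))"
        using * ss by (simp add: pos_le_divide_eq mult.commute)
      then show ?thesis using * ss by (simp add: f'_def h'_def inner_diff_left inner_add_left)
    qed
    \<comment> \<open>Apart from the terms with \<open>e\<close>, the three summands are 1, -2 and
      1, so the subtraction of \<open>e *\<^sub>R m\<close> makes the pairing negative.\<close>
    have "0 \<le> f' \<bullet> p00 + 2 * (g \<bullet> p01) + h' \<bullet> p11"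
      using C_min_pairing_nonneg[OF Amin CV pos] by (simp add: A_def)
    moreover have "f' \<bullet> p00 = 1 - e"
      by (simp add: f'_def p00_def m_def inner_diff_left inner_diff_right inner_add_right fc gc)
    moreover have "g \<bullet> p01 = - 1" by (simp add: p01_def inner_add_right gc)
    moreover have "(h + s *\<^sub>R g) \<bullet> p11 = s * (1 - s) - e"
      by (simp add: p11_def m_def inner_diff_right inner_add_left inner_add_right hc gc power2_eq_square algebra_simps)
    then have "h' \<bullet> p11 = (s * (1 - s) - e) / (s * (1 - s))" unfolding h'_def inner_scaleR_left by simp
    ultimately have "0 \<le> - e + (s * (1 - s) - e) / (s * (1 - s)) - 1" by linarith
    also have "\<dots> = - e - e / (s * (1 - s))" using s01 by (simp add: diff_divide_distrib)
    also have "\<dots> < 0" using e divide_pos_pos[OF e ss] by linarith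
    finally show False by simp
  qed
  have "finite I"
  proof (rule finite_pencil_spectrum[OF B1 B2 B3 B4, of "w0 ` S" I])
    show "B c1 x y + B c3 x y = B c2 x y + B c4 x y" for x y using ceq by (simp flip: Badd)
    show "finite (w0 ` S)" using S(1) by simp
    show "0 \<notin> I" "1 \<notin> I" by (simp_all add: I_def)
    fix s assume "s \<in> I"
    from singular[OF this] obtain w where w: "w \<in> span S" "Q s w w = 0" "N w w \<noteq> 0" by blast
    have "w0 w \<in> span (w0 ` S)" using w(1) linear_span_image[OF lin(1)] by blast
    moreover have "B c1 (w1 w) (w1 w) = 0 \<and> B c3 (w0 w) (w0 w) = 0 \<and>
      B c2 (w0 w + (s - 1) *\<^sub>R w1 w) (w0 w + (s - 1) *\<^sub>R w1 w) = 0 \<and>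
      B c4 (w0 w + s *\<^sub>R w1 w) (w0 w + s *\<^sub>R w1 w) = 0"
      using w(2) psd_bilinearD(5)[OF B1, of "w1 w"] psd_bilinearD(5)[OF B3, of "w0 w"]
        psd_bilinearD(5)[OF B2, of "w0 w + (s - 1) *\<^sub>R w1 w"] psd_bilinearD(5)[OF B4, of "w0 w + s *\<^sub>R w1 w"]
      unfolding Q_def by linarith
    moreover have "B c1 (w0 w) (w0 w) + B c3 (w0 w) (w0 w) + (B c1 (w1 w) (w1 w) + B c3 (w1 w) (w1 w)) \<noteq> 0"
      using w(3) by (simp add: N_def m_def Badd)
    ultimately show "\<exists>a\<in>span (w0 ` S). \<exists>b. B c1 b b = 0 \<and> B c3 a a = 0 \<and>
        B c2 (a + (s - 1) *\<^sub>R b) (a + (s - 1) *\<^sub>R b) = 0 \<and> B c4 (a + s *\<^sub>R b) (a + s *\<^sub>R b) = 0 \<and>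
        B c1 a a + B c3 a a + (B c1 b b + B c3 b b) \<noteq> 0" by blast
  qed
  then show False using infI by blast
qed

theorem theorem4p7:
  fixes C :: "(real ^ 'd) set" and u :: "real ^ 'd"
  assumes "convex_cone C" and "polyhedral_cone C" and "salient C"
    and "u \<in> interior C"
  shows "(fd_realizable (C_min C) u \<longleftrightarrow> simplex_cone C) \<and>
         ((\<forall>s\<ge>1. C_min C s = C_max C s) \<longleftrightarrow> simplex_cone C)"
proof -
  have "C_min C s = C_max C s" if "simplex_cone C" for s
    using C_min_subset_C_max[OF assms(1)] simplex_C_max_subset_C_min[OF that] by (rule subset_antisym)
  moreover have "fd_realizable (C_min C) u" if "\<forall>s\<ge>1. C_min C s = C_max C s"
    using polyhedral_cone_C_max_realizable[OF assms(2-4)] that unfolding fd_realizable_def by auto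
  ultimately show ?thesis using C_min_realizable_imp_simplex[OF assms] by blast
qed

end
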